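(* Let $k>1$ and $q>2$ be integers and let $\mathbb{K}\subset\mathbb{C}$ be a number field. For $1\le a<q/2$ with $\gcd(a,q)=1$, set $$\lambda_a:=\frac{\zeta(k,a/q)+(-1)^k\zeta(k,1-a/q)}{(\pi i)^k}.$$ Let $\widehat{V}_k(q,\mathbb{K})$ be the $\mathbb{K}$-linear span of the numbers $1$ and $\zeta(k,a/q)$ for $1\le a<q$, $\gcd(a,q)=1$. If $\lambda_a\in\mathbb{K}$ for some $a$ with $1\le a<q/2$, $\gcd(a,q)=1$, then $$2\le\dim_{\mathbb{K}}\widehat{V}_k(q,\mathbb{K})\le\frac{\varphi(q)}{2}+2.$$
   Context: For $0<x\le1$ and $\Re(s)>1$, the Hurwitz zeta function is $\zeta(s,x)=\sum_{n\ge0}(n+x)^{-s}$. $\varphi$ is Euler's totient function. *)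

theory Defs
  imports
    "HOL-Analysis.Analysis"
    "HOL-Number_Theory.Totient"
    "HOL-Algebra.Algebraic_Closure_Type"
begin

text \<open>Only meaningful for \<open>0 < x \<le> 1\<close> and \<open>Re s > 1\<close>, where the series converges absolutely;
  no analytic continuation is involved.\<close>

definition hurwitz_zeta :: "complex \<Rightarrow> real \<Rightarrow> complex" where
  "hurwitz_zeta s x = (\<Sum>n. (of_nat n + of_real x) powr (- s))"

text \<open>The complex field as an object of \<open>HOL-Algebra\<close>, so that the dimension theory over subfields
  given as sets (theory \<open>Embedded_Algebras\<close>) applies to it.\<close>

abbreviation complex_field :: "complex ring" where
  "complex_field \<equiv> ring_of_type_algebra"

definition number_field :: "complex set \<Rightarrow> bool" where
  "number_field K \<longleftrightarrow> subfield K complex_field \<and> ring.finite_dimension complex_field \<rat> K"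

definition lambda_hz :: "nat \<Rightarrow> nat \<Rightarrow> nat \<Rightarrow> complex" where
  "lambda_hz k q a =
     (hurwitz_zeta (of_nat k) (real a / real q)
        + (-1) ^ k * hurwitz_zeta (of_nat k) (1 - real a / real q))
     / (of_real pi * \<i>) ^ k"

text \<open>The span of \<open>1\<close> and of the values at the reduced fractions. The library's span takes a list of
  generators; it does not depend on their order.\<close>

definition V_hat :: "nat \<Rightarrow> nat \<Rightarrow> complex set \<Rightarrow> complex set" where
  "V_hat k q K = ring.Span complex_field K
     (1 # map (\<lambda>a. hurwitz_zeta (of_nat k) (real a / real q)) (filter (\<lambda>a. coprime a q) [1..<q]))"

text \<open>The dimension in \<open>Embedded_Algebras\<close> is a definite description, hence meaningful because of
  the following fact.\<close>

lemma finite_dimension_V_hat: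
  assumes "number_field K"
  shows "ring.finite_dimension complex_field K (V_hat k q K)"
proof -
  interpret R: ring complex_field
    by (rule field.is_ring) (rule field_from_type_algebra)
  show ?thesis
    unfolding V_hat_def using assms
    by (intro R.Span_finite_dimension) (auto simp: number_field_def ring_of_type_algebra_def)
qed

lemma subfield_Rats: "subfield \<rat> complex_field"
proof -
  interpret F: field complex_field
    by (rule field_from_type_algebra)
  have inv: "inv\<^bsub>complex_field\<^esub> x = inverse x" if "x \<noteq> 0" for x :: complex
    by (rule F.inv_char) (use that in \<open>auto simp: ring_of_type_algebra_def\<close>)
  have neg: "\<ominus>\<^bsub>complex_field\<^esub> x = - x" for x :: complex
    by (rule F.minus_equality) (auto simp: ring_of_type_algebra_def)
  show ?thesis
  proof (intro F.subfieldI' F.subringI)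
    show "inv\<^bsub>complex_field\<^esub> k \<in> \<rat>" if "k \<in> \<rat> - {\<zero>\<^bsub>complex_field\<^esub>}" for k
    proof -
      have "k \<in> \<rat>" "k \<noteq> 0"
        using that by (auto simp: ring_of_type_algebra_def)
      then show ?thesis
        by (simp add: inv)
    qed
  qed (simp_all add: neg, simp_all add: ring_of_type_algebra_def)
qed

end

theory Submission
  imports Defs "Jordan_Normal_Form.Char_Poly"
begin

text \<open>The reflection formula turns \<open>\<lambda>\<^sub>a\<close> into a rational multiple of \<open>Q(y\<^sub>a)\<close>, where
  \<open>y\<^sub>a = - \<i> cot (\<pi> a / q)\<close> and \<open>Q\<close> is a rational polynomial with the parity of \<open>k\<close>. The \<open>y\<^sub>b\<close> with
  \<open>0 < b < q\<close> are the roots, all simple, of \<open>(Y + 1)\<^sup>q - (Y - 1)\<^sup>q\<close>, and by monotonicity of the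
  polygamma functions only \<open>b = a\<close> and, for even \<open>k\<close>, \<open>b = q - a\<close> satisfy \<open>\<lambda>\<^sub>b = \<lambda>\<^sub>a\<close>. Taking a gcd over
  \<open>\<bbbK>\<close> of that polynomial with \<open>Q - Q(y\<^sub>a)\<close> puts \<open>y\<^sub>a\<close> (for even \<open>k\<close>: \<open>y\<^sub>a\<^sup>2\<close>) in \<open>\<bbbK>\<close>. Every \<open>y\<^sub>b\<close> is a
  rational function of \<open>y\<^sub>a\<close>, so all \<open>\<lambda>\<^sub>b\<close> lie in \<open>\<bbbK>\<close>. No Galois theory of cyclotomic fields is needed.
  Hence \<open>1\<close>, \<open>(\<pi> \<i>)\<^sup>k\<close> and the \<open>\<zeta>(k, b/q)\<close> with \<open>b < q/2\<close> span. If the dimension were at most one,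
  then \<open>(\<pi> \<i>)\<^sup>k = (\<zeta>(k, a/q) + (-1)\<^sup>k \<zeta>(k, 1 - a/q)) / \<lambda>\<^sub>a\<close> would be algebraic, which contradicts
  Lindemann's theorem that \<open>\<pi>\<close> is transcendental; the latter is obtained by Hermite's method from
  \<open>\<Prod>\<^sub>j (1 + exp \<alpha>\<^sub>j) = 0\<close>, the product running over the conjugates of a putative algebraic \<open>\<pi> \<i>\<close>.\<close>

hide_const (open) up_ring.coeff up_ring.monom module.smult Polynomials.lead_coeff
  Polynomials.degree Divisibility.prime Coset.order

section \<open>Algebraic integers\<close>

text \<open>For finite \<open>V\<close> this is the Z-module generated by \<open>V\<close>; for
  infinite \<open>V\<close> all sums are 0 by convention.\<close>

definition int_span :: "'a :: comm_ring_1 set \<Rightarrow> 'a set" where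
  "int_span V = {\<Sum>v\<in>V. of_int (c v) * v | c. True}"

lemma int_spanI: "x = (\<Sum>v\<in>V. of_int (c v) * v) \<Longrightarrow> x \<in> int_span V"
  unfolding int_span_def by auto

lemma int_span_base:
  assumes "finite V" "v \<in> V" shows "v \<in> int_span V"
proof (rule int_spanI)
  have "(\<Sum>u\<in>V. of_int (if u = v then 1 else 0) * u) = (\<Sum>u\<in>V. if u = v then v else 0)"
    by (rule sum.cong) auto
  with assms show "v = (\<Sum>u\<in>V. of_int (if u = v then 1 else 0) * u)"
    by simp
qed

lemma int_span_zero: "0 \<in> int_span V"
  by (rule int_spanI[where c = "\<lambda>_. 0"]) simp

lemma int_span_add:
  assumes "x \<in> int_span V" "y \<in> int_span V" shows "x + y \<in> int_span V"
proof -
  from assms obtain c d where "x = (\<Sum>v\<in>V. of_int (c v) * v)" "y = (\<Sum>v\<in>V. of_int (d v) * v)"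
    unfolding int_span_def by auto
  then show ?thesis
    by (intro int_spanI[where c = "\<lambda>v. c v + d v"]) (simp add: sum.distrib algebra_simps)
qed

lemma int_span_of_int_mult:
  assumes "x \<in> int_span V" shows "of_int a * x \<in> int_span V"
proof -
  from assms obtain c where "x = (\<Sum>v\<in>V. of_int (c v) * v)"
    unfolding int_span_def by auto
  then show ?thesis
    by (intro int_spanI[where c = "\<lambda>v. a * c v"]) (simp add: sum_distrib_left algebra_simps)
qed

lemma int_span_sum: "(\<And>i. i \<in> I \<Longrightarrow> f i \<in> int_span V) \<Longrightarrow> sum f I \<in> int_span V"
  by (induction I rule: infinite_finite_induct) (simp_all add: int_span_zero int_span_add)

text \<open>Linearity reduces stability to the generators; this allows multiplication by
  \<open>x\<close> after \<open>y\<close> in \<open>algebraic_int_mult\<close>.\<close>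

lemma int_span_stable:
  assumes "\<And>v. v \<in> V \<Longrightarrow> x * v \<in> int_span V" "y \<in> int_span V"
  shows "x * y \<in> int_span V"
proof -
  from assms(2) obtain c where "y = (\<Sum>v\<in>V. of_int (c v) * v)"
    unfolding int_span_def by auto
  then have "x * y = (\<Sum>v\<in>V. of_int (c v) * (x * v))"
    by (simp add: sum_distrib_left algebra_simps)
  then show ?thesis
    using assms(1) by (auto intro: int_span_sum int_span_of_int_mult)
qed

text \<open>The determinant trick: \<open>x\<close> is an eigenvalue of an integer matrix.\<close>

lemma algebraic_int_if_stable:
  fixes x :: "'a :: field_char_0"
  assumes fin: "finite V" and nz: "v0 \<in> V" "v0 \<noteq> 0"
    and stable: "\<And>v. v \<in> V \<Longrightarrow> x * v \<in> int_span V"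
  shows "algebraic_int x"
proof -
  define n where "n = card V"
  obtain f where f: "bij_betw f {..<n} V"
    using ex_bij_betw_nat_finite[OF fin] unfolding n_def lessThan_atLeast0 by blast
  have "\<forall>v\<in>V. \<exists>c. x * v = (\<Sum>u\<in>V. of_int (c u) * u)"
    using stable unfolding int_span_def by blast
  then obtain c where c: "\<And>v. v \<in> V \<Longrightarrow> x * v = (\<Sum>u\<in>V. of_int (c v u) * u)"
    by metis
  define A :: "int mat" where "A = mat n n (\<lambda>(i, j). c (f i) (f j))"
  \<comment> \<open>The relations \<open>c\<close> make the vector of generators an eigenvector of
    \<open>A\<close> with eigenvalue \<open>x\<close>; it is nonzero because of
    \<open>v0\<close>.\<close>
  define w where "w = vec n f"
  have A: "A \<in> carrier_mat n n"
    by (simp add: A_def)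
  obtain i where i: "i < n" "f i = v0"
    using f nz(1) by (auto simp: bij_betw_def)
  have "w \<noteq> 0\<^sub>v n"
  proof
    assume "w = 0\<^sub>v n"
    then have "vec_index w i = 0"
      using i by simp
    then show False
      using i nz by (simp add: w_def)
  qed
  moreover have "map_mat of_int A *\<^sub>v w = x \<cdot>\<^sub>v w"
  proof (rule eq_vecI)
    fix i assume "i < dim_vec (x \<cdot>\<^sub>v w)"
    then have i: "i < n" by (simp add: w_def)
    then have "f i \<in> V" using f by (auto simp: bij_betw_def)
    have "vec_index (map_mat of_int A *\<^sub>v w) i = (\<Sum>j<n. of_int (c (f i) (f j)) * f j)"
      using i by (simp add: A_def w_def scalar_prod_def lessThan_atLeast0)
    also have "\<dots> = (\<Sum>u\<in>V. of_int (c (f i) u) * u)"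
      by (rule sum.reindex_bij_betw[OF f])
    also have "\<dots> = x * f i"
      using c[OF \<open>f i \<in> V\<close>] by simp
    finally show "vec_index (map_mat of_int A *\<^sub>v w) i = vec_index (x \<cdot>\<^sub>v w) i"
      using i by (simp add: w_def)
  qed (simp add: w_def A_def)
  ultimately have "eigenvalue (map_mat of_int A) x"
    unfolding eigenvalue_def eigenvector_def
    by (intro exI[of _ w]) (simp add: A_def w_def)
  then have "poly (char_poly (map_mat of_int A)) x = 0"
    using eigenvalue_root_char_poly[of "map_mat of_int A" n x] A by simp
  then have "poly (map_poly of_int (char_poly A)) x = 0"
    by (simp add: of_int_hom.char_poly_hom[OF A])
  moreover have "lead_coeff (char_poly A) = 1"
    using degree_monic_char_poly[OF A] by simp
  ultimately show ?thesis
    unfolding algebraic_int_altdef_ipoly by blast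
qed

text \<open>The monic equation solved for its top power. \<open>n > 0\<close> because a monic
  constant has no root.\<close>

lemma algebraic_int_power_reduce:
  fixes x :: "'a :: field_char_0"
  assumes "algebraic_int x"
  obtains n c where "n > 0" "x ^ n = (\<Sum>i<n. of_int (c i) * x ^ i)"
proof -
  from assms obtain p where p: "poly (map_poly of_int p) x = 0" "lead_coeff p = 1"
    unfolding algebraic_int_altdef_ipoly by blast
  define n where "n = degree p"
  have "n > 0"
  proof (rule ccontr)
    assume "\<not> n > 0"
    then obtain a where "p = [:a:]"
      by (auto simp: n_def elim: degree_eq_zeroE)
    then show False using p by simp
  qed
  have "0 = (\<Sum>i\<le>n. of_int (coeff p i) * x ^ i)"
    using p(1) by (simp add: poly_altdef n_def coeff_map_poly degree_map_poly)
  also have "\<dots> = x ^ n + (\<Sum>i<n. of_int (coeff p i) * x ^ i)"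
    using p(2) by (simp add: n_def lessThan_Suc_atMost[symmetric] algebra_simps)
  finally have "x ^ n = (\<Sum>i<n. of_int (- coeff p i) * x ^ i)"
    by (simp add: sum_negf add_eq_0_iff2)
  with \<open>n > 0\<close> show thesis by (rule that)
qed

text \<open>The monomials \<open>x ^ i * y ^ j\<close> with \<open>i < n\<close>,
  \<open>j < m\<close> generate such a module: an exponent leaves its range only by reaching
  \<open>n\<close> or \<open>m\<close>, where the monic relation rewrites the power.\<close>

lemma algebraic_int_common_lattice:
  fixes x y :: "'a :: field_char_0"
  assumes "algebraic_int x" "algebraic_int y"
  obtains V where "finite V" "1 \<in> V"
    "\<forall>v\<in>V. x * v \<in> int_span V" "\<forall>v\<in>V. y * v \<in> int_span V"
proof -
  obtain n c where n: "n > 0" "x ^ n = (\<Sum>i<n. of_int (c i) * x ^ i)"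
    by (rule algebraic_int_power_reduce[OF assms(1)])
  obtain m d where m: "m > 0" "y ^ m = (\<Sum>i<m. of_int (d i) * y ^ i)"
    by (rule algebraic_int_power_reduce[OF assms(2)])
  define V where "V = (\<lambda>(i, j). x ^ i * y ^ j) ` ({..<n} \<times> {..<m})"
  have V: "x ^ i * y ^ j \<in> V" if "i < n" "j < m" for i j
    using that unfolding V_def by force
  have fin: "finite V" by (simp add: V_def)
  show thesis
  proof (rule that[OF fin])
    show "1 \<in> V" using V[of 0 0] n m by simp
    have "x * v \<in> int_span V \<and> y * v \<in> int_span V" if "v \<in> V" for v
    proof
      from that obtain i j where ij: "i < n" "j < m" "v = x ^ i * y ^ j"
        unfolding V_def by auto
      show "x * v \<in> int_span V"
      proof (cases "Suc i < n")
        case True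
        then show ?thesis
          using int_span_base[OF fin V[OF True ij(2)]] ij by (simp add: mult_ac)
      next
        case False
        then have "Suc i = n" using ij by simp
        then have "x * v = x ^ n * y ^ j" using ij by auto
        also have "\<dots> = (\<Sum>l<n. of_int (c l) * (x ^ l * y ^ j))"
          by (simp add: n(2) sum_distrib_left sum_distrib_right mult_ac)
        finally show ?thesis
          using ij by (auto intro!: int_span_sum int_span_of_int_mult int_span_base fin V)
      qed
      show "y * v \<in> int_span V"
      proof (cases "Suc j < m")
        case True
        then show ?thesis
          using int_span_base[OF fin V[OF ij(1) True]] ij by (simp add: mult_ac)
      next
        case False
        then have "Suc j = m" using ij by simp
        then have "y * v = x ^ i * y ^ m" using ij by auto
        also have "\<dots> = (\<Sum>l<m. of_int (d l) * (x ^ i * y ^ l))"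
          by (simp add: m(2) sum_distrib_left mult_ac)
        finally show ?thesis
          using ij by (auto intro!: int_span_sum int_span_of_int_mult int_span_base fin V)
      qed
    qed
    then show "\<forall>v\<in>V. x * v \<in> int_span V" "\<forall>v\<in>V. y * v \<in> int_span V"
      by blast+
  qed
qed

lemma algebraic_int_add:
  fixes x y :: "'a :: field_char_0"
  assumes "algebraic_int x" "algebraic_int y"
  shows "algebraic_int (x + y)"
proof -
  obtain V where V: "finite V" "1 \<in> V"
    "\<forall>v\<in>V. x * v \<in> int_span V" "\<forall>v\<in>V. y * v \<in> int_span V"
    by (rule algebraic_int_common_lattice[OF assms])
  show ?thesis
    using V by (intro algebraic_int_if_stable[of V 1]) (auto simp: ring_distribs intro: int_span_add)
qed

lemma algebraic_int_mult:
  fixes x y :: "'a :: field_char_0"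
  assumes "algebraic_int x" "algebraic_int y"
  shows "algebraic_int (x * y)"
proof -
  obtain V where V: "finite V" "1 \<in> V"
    "\<forall>v\<in>V. x * v \<in> int_span V" "\<forall>v\<in>V. y * v \<in> int_span V"
    by (rule algebraic_int_common_lattice[OF assms])
  show ?thesis
    using V by (intro algebraic_int_if_stable[of V 1]) (auto simp: mult.assoc intro: int_span_stable)
qed

lemma algebraic_int_sum:
  fixes f :: "'b \<Rightarrow> 'a :: field_char_0"
  shows "(\<And>i. i \<in> I \<Longrightarrow> algebraic_int (f i)) \<Longrightarrow> algebraic_int (sum f I)"
  by (induction I rule: infinite_finite_induct) (simp_all add: algebraic_int_add)

lemma algebraic_int_power:
  fixes x :: "'a :: field_char_0"
  shows "algebraic_int x \<Longrightarrow> algebraic_int (x ^ n)"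
  by (induction n) (simp_all add: algebraic_int_mult int_imp_algebraic_int)

text \<open>With \<open>c\<close> the leading coefficient and \<open>n\<close> the degree,
  multiplying the equation by \<open>c ^ (n - 1)\<close> turns it into a monic one for
  \<open>c * x\<close>.\<close>

lemma algebraic_int_lead_coeff_mult:
  fixes x :: "'a :: field_char_0"
  assumes "poly (map_poly of_int p) x = 0" "p \<noteq> 0"
  shows "algebraic_int (of_int (lead_coeff p) * x)"
proof -
  define n where "n = degree p"
  define c where "c = lead_coeff p"
  have "n > 0"
  proof (rule ccontr)
    assume "\<not> n > 0"
    then obtain a where "p = [:a:]"
      by (auto simp: n_def elim: degree_eq_zeroE)
    then show False using assms by simp
  qed
  define q where "q = monom 1 n + (\<Sum>i<n. monom (coeff p i * c ^ (n - 1 - i)) i)"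
  have cq: "coeff q i = (if i = n then 1 else if i < n then coeff p i * c ^ (n - 1 - i) else 0)" for i
    by (simp add: q_def coeff_sum)
  have "degree q = n"
    by (rule antisym) (auto intro: degree_le le_degree simp: cq)
  have "poly (map_poly of_int q) (of_int c * x)
      = (\<Sum>i\<le>n. of_int (coeff q i) * (of_int c * x) ^ i)"
    by (simp add: poly_altdef coeff_map_poly degree_map_poly \<open>degree q = n\<close>)
  also have "\<dots> = (\<Sum>i\<le>n. of_int c ^ (n - 1) * (of_int (coeff p i) * x ^ i))"
  proof (rule sum.cong)
    fix i assume "i \<in> {..n}"
    consider "i = n" | "i < n" using \<open>i \<in> {..n}\<close> by force
    then show "of_int (coeff q i) * (of_int c * x) ^ i = of_int c ^ (n - 1) * (of_int (coeff p i) * x ^ i)"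
    proof cases
      case 1
      have "c ^ n = c ^ (n - 1) * c"
        using \<open>n > 0\<close> by (metis power_minus_mult)
      then have "(of_int c :: 'a) ^ n = of_int c ^ (n - 1) * of_int c"
        by (metis of_int_mult of_int_power)
      then show ?thesis
        using 1 by (simp add: cq c_def n_def power_mult_distrib)
    next
      case 2
      then have "(of_int c :: 'a) ^ (n - 1 - i) * of_int c ^ i = of_int c ^ (n - 1)"
        by (simp flip: power_add)
      then show ?thesis
        using 2 by (simp add: cq power_mult_distrib mult_ac)
    qed
  qed simp
  also have "\<dots> = of_int c ^ (n - 1) * poly (map_poly of_int p) x"
    by (simp add: poly_altdef coeff_map_poly degree_map_poly n_def sum_distrib_left)
  finally have "poly (map_poly of_int q) (of_int c * x) = 0"
    using assms by simp
  moreover have "lead_coeff q = 1"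
    by (simp add: \<open>degree q = n\<close> cq)
  ultimately show ?thesis
    unfolding algebraic_int_altdef_ipoly c_def by blast
qed

section \<open>Power sums of subset sums\<close>

text \<open>Comparing coefficients gives a recursion for those of \<open>g\<close>, solvable because
  the constant term of \<open>f\<close> is nonzero.\<close>

lemma fps_quotient_Rats:
  fixes f g :: "'a :: field_char_0 fps"
  assumes f: "\<And>n. fps_nth f n \<in> \<rat>" and fg: "\<And>n. fps_nth (f * g) n \<in> \<rat>"
    and f0: "fps_nth f 0 \<noteq> 0"
  shows "fps_nth g n \<in> \<rat>"
proof (induction n rule: less_induct)
  case (less n)
  have "fps_nth (f * g) n = fps_nth f 0 * fps_nth g n + (\<Sum>i=Suc 0..n. fps_nth f i * fps_nth g (n - i))"
    by (simp add: fps_mult_nth sum.atLeast_Suc_atMost)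
  then have "fps_nth g n
      = (fps_nth (f * g) n - (\<Sum>i=Suc 0..n. fps_nth f i * fps_nth g (n - i))) / fps_nth f 0"
    using f0 by (simp add: field_simps)
  moreover have "(\<Sum>i=Suc 0..n. fps_nth f i * fps_nth g (n - i)) \<in> \<rat>"
    using f less by (intro Rats_sum) auto
  ultimately show ?case
    using f fg by (metis Rats_diff Rats_divide)
qed

text \<open>\<open>L i\<close> stands for the logarithmic derivative of \<open>f i\<close>; the
  multiplicative form avoids inverses of power series.\<close>

lemma fps_deriv_prod_logarithmic:
  fixes f L :: "'i \<Rightarrow> 'a :: field_char_0 fps"
  assumes "\<And>i. i \<in> I \<Longrightarrow> fps_deriv (f i) = f i * L i"
  shows "fps_deriv (prod f I) = prod f I * sum L I"
  using assms by (induction I rule: infinite_finite_induct) (simp_all add: algebra_simps)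

text \<open>Newton's identities by generating functions: the product of the
  \<open>1 - a j * X\<close> is the reversed polynomial, and its logarithmic derivative has the
  negated power sums as coefficients.\<close>

lemma power_sum_roots_Rats:
  fixes a :: "'i \<Rightarrow> complex"
  assumes rat: "\<And>n. coeff (\<Prod>j\<in>I. [:- a j, 1:]) n \<in> \<rat>"
  shows "(\<Sum>j\<in>I. a j ^ Suc n) \<in> \<rat>"
proof -
  define f where "f j = fps_of_poly [:1, - a j:]" for j
  define L where "L j = - Abs_fps (\<lambda>n. a j ^ Suc n)" for j
  have deriv: "fps_deriv (f j) = f j * L j" for j
  proof (rule fps_ext)
    fix n
    have f: "f j = 1 - fps_const (a j) * fps_X"
      by (simp add: f_def fps_of_poly_pCons fps_const_neg[symmetric] del: fps_const_neg)
    show "fps_nth (fps_deriv (f j)) n = fps_nth (f j * L j) n"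
      by (cases n) (simp_all add: f L_def algebra_simps fps_X_mult_nth)
  qed
  have prod_f: "prod f I = fps_of_poly (reflect_poly (\<Prod>j\<in>I. [:- a j, 1:]))"
  proof -
    have "reflect_poly [:- a j, 1:] = [:1, - a j:]" for j
      by (simp add: reflect_poly_pCons' monom_altdef)
    then show ?thesis
      by (simp add: reflect_poly_prod fps_of_poly_prod f_def)
  qed
  have "fps_nth (prod f I) n \<in> \<rat>" for n
    using rat by (auto simp: prod_f coeff_reflect_poly)
  moreover from this have "fps_nth (prod f I * sum L I) n \<in> \<rat>" for n
    by (subst fps_deriv_prod_logarithmic[symmetric]) (auto simp: deriv)
  moreover have "fps_nth (prod f I) 0 \<noteq> 0"
    by (simp add: f_def flip: fps_of_poly_prod add: poly_prod poly_0_coeff_0[symmetric])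
  ultimately have "fps_nth (sum L I) n \<in> \<rat>"
    by (rule fps_quotient_Rats)
  then show ?thesis
    by (simp add: L_def fps_sum_nth sum_negf)
qed

text \<open>The power sums of the subset sums are read off from \<open>\<Prod>\<^sub>j (1 + exp (a\<^sub>j X))\<close>. The logarithmic
  derivative of this series has rational coefficients, which replaces the fundamental theorem on
  symmetric polynomials.\<close>

lemma subset_sum_power_sum_Rats:
  fixes a :: "'i \<Rightarrow> complex"
  assumes fin: "finite I" and rat: "\<And>n. coeff (\<Prod>j\<in>I. [:- a j, 1:]) n \<in> \<rat>"
  shows "(\<Sum>S\<in>Pow I. (sum a S) ^ n) \<in> \<rat>"
proof -
  define E where "E = 1 + fps_exp (1 :: complex)"
  \<comment> \<open>\<open>\<Phi>\<close> is the logarithmic derivative of \<open>E\<close>.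
    Substituting \<open>a j * X\<close> and multiplying by \<open>a j\<close> gives that of
    \<open>1 + exp (a j * X)\<close>.\<close>
  define \<Phi> where "\<Phi> = fps_exp 1 * inverse E"
  have E\<Phi>: "E * \<Phi> = fps_exp 1"
    by (simp add: \<Phi>_def E_def mult.left_commute[of "1 + _"] inverse_mult_eq_1')
  have \<Phi>_rat: "fps_nth \<Phi> n \<in> \<rat>" for n
  proof (rule fps_quotient_Rats)
    have "1 / fact n \<in> (\<rat> :: complex set)" for n
      by (intro Rats_divide subsetD[OF Ints_subset_Rats fact_in_Ints]) auto
    then show "fps_nth E n \<in> \<rat>" "fps_nth (E * \<Phi>) n \<in> \<rat>" for n
      by (auto simp: E_def E\<Phi>[unfolded E_def])
    show "fps_nth E 0 \<noteq> 0"
      by (simp add: E_def)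
  qed
  define f where "f j = 1 + fps_exp (a j)" for j
  define L where "L j = fps_const (a j) * (\<Phi> oo (fps_const (a j) * fps_X))" for j
  have deriv: "fps_deriv (f j) = f j * L j" for j
  proof -
    have "f j = E oo (fps_const (a j) * fps_X)"
      by (simp add: f_def E_def fps_compose_add_distrib fps_exp_compose_linear)
    then have "f j * L j = fps_const (a j) * ((E * \<Phi>) oo (fps_const (a j) * fps_X))"
      by (simp add: L_def fps_compose_mult_distrib mult_ac)
    also have "\<dots> = fps_deriv (f j)"
      by (simp add: E\<Phi> f_def fps_exp_compose_linear)
    finally show ?thesis by simp
  qed
  have L_rat: "fps_nth (sum L I) n \<in> \<rat>" for n
  proof -
    \<comment> \<open>The \<open>a j\<close> enter only through their power sums, which are rational
      by Newton's identities.\<close>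
    have "fps_nth (sum L I) n = fps_nth \<Phi> n * (\<Sum>j\<in>I. a j ^ Suc n)"
      by (simp add: fps_sum_nth L_def fps_nth_compose_linear sum_distrib_left)
        (simp add: mult_ac)
    then show ?thesis
      using \<Phi>_rat power_sum_roots_Rats[OF rat] by simp
  qed
  \<comment> \<open>The differential equation of the product determines the coefficient of degree
    \<open>m + 1\<close> from those of degree at most \<open>m\<close>.\<close>
  have "fps_nth (prod f I) n \<in> \<rat>" for n
  proof (induction n rule: less_induct)
    case (less n)
    show ?case
    proof (cases n)
      case 0
      have "fps_nth (prod f J) 0 \<in> \<rat>" for J
        by (induction J rule: infinite_finite_induct) (simp_all add: f_def)
      with 0 show ?thesis
        by simp
    next
      case (Suc m)
      have "of_nat (Suc m) * fps_nth (prod f I) (Suc m) = fps_nth (prod f I * sum L I) m"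
        by (subst fps_deriv_prod_logarithmic[symmetric]) (auto simp: deriv)
      also have "\<dots> \<in> \<rat>"
        unfolding fps_mult_nth using less Suc L_rat by (intro Rats_sum) auto
      finally have "of_nat (Suc m) * fps_nth (prod f I) (Suc m) / of_nat (Suc m) \<in> \<rat>"
        by (intro Rats_divide) auto
      then show ?thesis
        using Suc by (simp del: of_nat_Suc)
    qed
  qed
  moreover have "prod f I = (\<Sum>S\<in>Pow I. fps_exp (sum a S))"
  proof -
    have "prod (\<lambda>j. fps_exp (a j)) S = fps_exp (sum a S)" for S
      by (induction S rule: infinite_finite_induct) (simp_all add: fps_exp_add_mult)
    then show ?thesis
      unfolding f_def using prod_add[OF fin, of "\<lambda>j. fps_exp (a j)" "\<lambda>_. 1"] by (simp add: add.commute)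
  qed
  ultimately have "(\<Sum>S\<in>Pow I. sum a S ^ n / fact n) * fact n \<in> \<rat>"
    by (intro Rats_mult subsetD[OF Ints_subset_Rats fact_in_Ints]) (simp add: fps_sum_nth)
  then show ?thesis
    by (simp add: sum_distrib_right)
qed

section \<open>Transcendence of \<open>\<pi>\<close>\<close>

abbreviation eval_int_poly :: "int poly \<Rightarrow> complex \<Rightarrow> complex" where
  "eval_int_poly p x \<equiv> poly (map_poly of_int p) x"

abbreviation abs_poly :: "int poly \<Rightarrow> real poly" where
  "abs_poly p \<equiv> map_poly (\<lambda>c. \<bar>real_of_int c\<bar>) p"

text \<open>Hermite's \<open>f + f' + f'' + ...\<close>, cut off where the derivatives
  vanish.\<close>

definition deriv_sum :: "int poly \<Rightarrow> complex \<Rightarrow> complex" where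
  "deriv_sum f x = (\<Sum>j\<le>degree f. eval_int_poly ((pderiv ^^ j) f) x)"

section \<open>Hermite's identity and its remainder\<close>

lemma higher_pderiv_monom_eval:
  fixes c x :: "'a :: field_char_0"
  shows "poly ((pderiv ^^ j) (monom c n)) x
           = (if j \<le> n then c * fact n / fact (n - j) * x ^ (n - j) else 0)"
proof (induction j arbitrary: c n)
  case 0
  then show ?case by (simp add: poly_monom)
next
  case (Suc j)
  have "(pderiv ^^ Suc j) (monom c n) = (pderiv ^^ j) (monom (of_nat n * c) (n - 1))"
    by (simp add: funpow_Suc_right pderiv_monom del: funpow.simps)
  then show ?case
    by (cases n) (simp_all add: Suc.IH mult_ac)
qed

text \<open>By linearity only monomials matter, and \<open>X ^ n\<close> yields \<open>n!\<close>
  times the partial sum of the exponential series up to degree \<open>n\<close>.\<close>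

lemma sum_higher_pderiv_eval:
  fixes f :: "'a :: field_char_0 poly"
  shows "(\<Sum>j\<le>degree f. poly ((pderiv ^^ j) f) x)
           = (\<Sum>n\<le>degree f. coeff f n * (fact n * (\<Sum>k\<le>n. x ^ k / fact k)))"
proof -
  have "(pderiv ^^ j) f = (\<Sum>n\<le>degree f. (pderiv ^^ j) (monom (coeff f n) n))" for j
    by (subst higher_pderiv_sum[symmetric]) (simp add: poly_as_sum_of_monoms)
  then have "(\<Sum>j\<le>degree f. poly ((pderiv ^^ j) f) x)
      = (\<Sum>j\<le>degree f. \<Sum>n\<le>degree f. poly ((pderiv ^^ j) (monom (coeff f n) n)) x)"
    by (simp add: poly_sum)
  also have "\<dots> = (\<Sum>n\<le>degree f. \<Sum>j\<le>degree f. poly ((pderiv ^^ j) (monom (coeff f n) n)) x)"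
    by (rule sum.swap)
  also have "\<dots> = (\<Sum>n\<le>degree f. coeff f n * (fact n * (\<Sum>k\<le>n. x ^ k / fact k)))"
  proof (rule sum.cong)
    fix n assume n: "n \<in> {..degree f}"
    have "(\<Sum>j\<le>degree f. poly ((pderiv ^^ j) (monom (coeff f n) n)) x)
        = (\<Sum>j\<le>n. coeff f n * fact n * (x ^ (n - j) / fact (n - j)))"
      using n by (intro sum.mono_neutral_cong_right) (auto simp: higher_pderiv_monom_eval)
    also have "\<dots> = (\<Sum>k\<le>n. coeff f n * fact n * (x ^ k / fact k))"
      by (rule sum.reindex_bij_witness[of _ "\<lambda>k. n - k" "\<lambda>k. n - k"]) auto
    finally show "(\<Sum>j\<le>degree f. poly ((pderiv ^^ j) (monom (coeff f n) n)) x)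
        = coeff f n * (fact n * (\<Sum>k\<le>n. x ^ k / fact k))"
      by (simp add: sum_distrib_left mult_ac)
  qed simp
  finally show ?thesis .
qed

lemma higher_pderiv_map_of_int:
  "map_poly of_int ((pderiv ^^ j) f) = (pderiv ^^ j) (map_poly of_int f :: 'a :: field_char_0 poly)"
  by (induction j) (simp_all add: of_int_hom.map_poly_pderiv)

lemma degree_abs_poly [simp]: "degree (abs_poly p) = degree p"
  by (rule degree_map_poly) simp

lemma abs_poly_eval: "poly (abs_poly f) r = (\<Sum>n\<le>degree f. \<bar>real_of_int (coeff f n)\<bar> * r ^ n)"
  by (simp add: poly_altdef coeff_map_poly)

text \<open>Each monomial \<open>X ^ n\<close> contributes \<open>n!\<close> times the Taylor
  remainder of exp after degree \<open>n\<close>. The bound for that remainder carries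
  \<open>1 / n!\<close>, so the factorials cancel.\<close>

lemma hermite_estimate:
  "cmod (exp x * deriv_sum f 0 - deriv_sum f x) \<le> exp (cmod x) * cmod x * poly (abs_poly f) (cmod x)"
proof -
  have deriv_sum: "deriv_sum f y = (\<Sum>n\<le>degree f. of_int (coeff f n) * (fact n * (\<Sum>k\<le>n. y ^ k / fact k)))" for y
    using sum_higher_pderiv_eval[of "map_poly of_int f :: complex poly" y]
    by (simp add: deriv_sum_def higher_pderiv_map_of_int coeff_map_poly degree_map_poly)
  have zero: "(\<Sum>k\<le>n. (0::complex) ^ k / fact k) = 1" for n
    by (induction n) auto
  have "exp x * deriv_sum f 0 - deriv_sum f x
      = (\<Sum>n\<le>degree f. of_int (coeff f n) * (fact n * (exp x - (\<Sum>k\<le>n. x ^ k / fact k))))"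
    unfolding deriv_sum zero by (simp add: sum_distrib_left ring_distribs sum_subtractf mult_ac)
  also have "cmod \<dots> \<le> (\<Sum>n\<le>degree f. exp (cmod x) * cmod x * (\<bar>real_of_int (coeff f n)\<bar> * cmod x ^ n))"
  proof (rule sum_norm_le)
    fix n
    have "fact n * cmod (exp x - (\<Sum>k\<le>n. x ^ k / fact k))
        \<le> fact n * (exp (cmod x) * (cmod x ^ Suc n) / fact n)"
      by (intro mult_left_mono Taylor_exp_field) auto
    also have "\<dots> = exp (cmod x) * cmod x * cmod x ^ n"
      by simp
    finally have "\<bar>real_of_int (coeff f n)\<bar> * (fact n * cmod (exp x - (\<Sum>k\<le>n. x ^ k / fact k)))
        \<le> \<bar>real_of_int (coeff f n)\<bar> * (exp (cmod x) * cmod x * cmod x ^ n)"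
      by (rule mult_left_mono) simp
    then show "cmod (of_int (coeff f n) * (fact n * (exp x - (\<Sum>k\<le>n. x ^ k / fact k))))
        \<le> exp (cmod x) * cmod x * (\<bar>real_of_int (coeff f n)\<bar> * cmod x ^ n)"
      by (simp add: norm_mult mult_ac)
  qed
  finally show ?thesis
    by (simp add: abs_poly_eval sum_distrib_left)
qed

section \<open>Majorants by absolute values of coefficients\<close>

lemma poly_altdef_bound:
  fixes p :: "'a :: comm_semiring_1 poly"
  assumes "degree p \<le> N"
  shows "poly p x = (\<Sum>i\<le>N. coeff p i * x ^ i)"
  unfolding poly_altdef using assms
  by (intro sum.mono_neutral_left) (auto simp: coeff_eq_0)

lemma abs_poly_mult_le:
  assumes "r \<ge> 0"
  shows "poly (abs_poly (f * g)) r \<le> poly (abs_poly f) r * poly (abs_poly g) r"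
proof -
  have "poly (abs_poly (f * g)) r = (\<Sum>i\<le>degree f + degree g. coeff (abs_poly (f * g)) i * r ^ i)"
    by (rule poly_altdef_bound) (simp add: degree_mult_le)
  also have "\<dots> \<le> (\<Sum>i\<le>degree f + degree g. coeff (abs_poly f * abs_poly g) i * r ^ i)"
  proof (intro sum_mono mult_right_mono)
    fix i
    have "\<bar>\<Sum>k\<le>i. real_of_int (coeff f k * coeff g (i - k))\<bar>
        \<le> (\<Sum>k\<le>i. \<bar>real_of_int (coeff f k * coeff g (i - k))\<bar>)"
      by (rule sum_abs)
    then show "coeff (abs_poly (f * g)) i \<le> coeff (abs_poly f * abs_poly g) i"
      by (simp add: coeff_map_poly coeff_mult abs_mult)
  qed (use assms in auto)
  also have "\<dots> = poly (abs_poly f * abs_poly g) r"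
    by (rule poly_altdef_bound[symmetric]) (simp add: order_trans[OF degree_mult_le])
  finally show ?thesis by simp
qed

lemma abs_poly_nonneg: "r \<ge> 0 \<Longrightarrow> poly (abs_poly f) r \<ge> 0"
  by (auto simp: abs_poly_eval intro!: sum_nonneg)

lemma abs_poly_power_le:
  assumes "r \<ge> 0"
  shows "poly (abs_poly (f ^ n)) r \<le> poly (abs_poly f) r ^ n"
proof (induction n)
  case 0
  then show ?case by (simp add: abs_poly_eval)
next
  case (Suc n)
  have "poly (abs_poly (f ^ Suc n)) r \<le> poly (abs_poly f) r * poly (abs_poly (f ^ n)) r"
    using abs_poly_mult_le[OF assms, of f "f ^ n"] by simp
  also have "\<dots> \<le> poly (abs_poly f) r * poly (abs_poly f) r ^ n"
    by (intro mult_left_mono Suc abs_poly_nonneg assms)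
  finally show ?case by simp
qed

section \<open>Divisibility of higher derivatives\<close>

lemma power_dvd_higher_pderiv:
  fixes f g :: "'a :: idom poly"
  assumes "g ^ p dvd f"
  shows "g ^ (p - j) dvd (pderiv ^^ j) f"
proof (induction j)
  case 0
  then show ?case using assms by simp
next
  case (Suc j)
  \<comment> \<open>One differentiation loses at most one factor \<open>g\<close>; from
    \<open>j = p\<close> on the truncated \<open>p - j\<close> makes the claim trivial.\<close>
  have *: "g ^ m dvd pderiv h" if "g ^ Suc m dvd h" for m h
  proof -
    from that obtain u where "h = g ^ Suc m * u" by (elim dvdE)
    then have "pderiv h = g ^ Suc m * pderiv u
        + u * (Polynomial.smult (of_nat (Suc m)) (g ^ m) * pderiv g)"
      by (simp only: pderiv_mult pderiv_power_Suc)
    also have "\<dots> = g ^ m * (g * pderiv u + u * Polynomial.smult (of_nat (Suc m)) (pderiv g))"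
      by (simp add: algebra_simps del: of_nat_Suc)
    finally show ?thesis by simp
  qed
  show ?case
  proof (cases "p - j")
    case (Suc m)
    then have "p - Suc j = m" by simp
    with Suc show ?thesis
      using *[of m "(pderiv ^^ j) f"] Suc.IH by simp
  qed simp
qed

text \<open>A coefficient of the \<open>j\<close>-th derivative carries a product of
  \<open>j\<close> consecutive integers, which \<open>j!\<close> divides.\<close>

lemma fact_dvd_higher_pderiv:
  fixes f :: "int poly"
  assumes "p \<le> j"
  shows "[:fact p:] dvd (pderiv ^^ j) f"
  unfolding const_poly_dvd_iff coeff_higher_pderiv
proof
  fix n
  have "(fact p :: int) dvd fact j"
    using assms by (rule fact_dvd)
  also have "fact j dvd pochhammer (int (Suc n)) j"
    by (rule fact_dvd_pochhammer)
  finally show "fact p dvd pochhammer (of_nat (Suc n)) j * coeff f (n + j)"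
    by simp
qed

lemma deriv_sum_zero_eq: "deriv_sum f 0 = of_int (\<Sum>j\<le>degree f. fact j * coeff f j)"
  by (simp add: deriv_sum_def poly_0_coeff_0 coeff_map_poly coeff_higher_pderiv
      pochhammer_fact[symmetric])

lemma power_over_fact_tendsto_0: "(\<lambda>n. x ^ n / fact n) \<longlonglongrightarrow> (0 :: real)"
  using summable_LIMSEQ_zero[OF summable_exp[of x]] by (simp add: field_simps)

text \<open>The term of degree \<open>k\<close> uses up \<open>c ^ k\<close>; the spare
  \<open>c ^ (D - k)\<close> is an integer factor.\<close>

lemma power_sum_eval_Ints:
  fixes \<beta> :: "'i \<Rightarrow> complex"
  assumes pow: "\<And>n. of_int c ^ n * (\<Sum>i\<in>B. \<beta> i ^ n) \<in> \<int>" and deg: "degree h \<le> D"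
  shows "of_int c ^ D * (\<Sum>i\<in>B. eval_int_poly h (\<beta> i)) \<in> \<int>"
proof -
  have "degree (map_poly of_int h :: complex poly) \<le> D"
    by (rule order_trans[OF degree_map_poly_le deg])
  then have "eval_int_poly h x = (\<Sum>k\<le>D. of_int (coeff h k) * x ^ k)" for x
    by (subst poly_altdef_bound) (simp_all add: coeff_map_poly)
  then have "of_int c ^ D * (\<Sum>i\<in>B. eval_int_poly h (\<beta> i))
      = of_int c ^ D * (\<Sum>i\<in>B. \<Sum>k\<le>D. of_int (coeff h k) * \<beta> i ^ k)"
    by simp
  also have "\<dots> = of_int c ^ D * (\<Sum>k\<le>D. \<Sum>i\<in>B. of_int (coeff h k) * \<beta> i ^ k)"
    by (subst sum.swap) simp
  also have "\<dots> = (\<Sum>k\<le>D. of_int (coeff h k * c ^ (D - k)) * (of_int c ^ k * (\<Sum>i\<in>B. \<beta> i ^ k)))"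
  proof (unfold sum_distrib_left, intro sum.cong refl)
    fix k i assume "k \<in> {..D}"
    then have "(of_int c :: complex) ^ D = of_int c ^ (D - k) * of_int c ^ k"
      by (simp flip: power_add)
    then show "of_int c ^ D * (of_int (coeff h k) * \<beta> i ^ k)
        = of_int (coeff h k * c ^ (D - k)) * (of_int c ^ k * \<beta> i ^ k)"
      by simp
  qed
  also have "\<dots> \<in> \<int>"
    using pow by (intro Ints_sum Ints_mult[OF Ints_of_int])
  finally show ?thesis .
qed

text \<open>The arithmetic half of Hermite's argument, for the auxiliary polynomial
  \<open>X\<^bsup>p-1\<^esup> g\<^sup>p\<close>: up to a multiple of \<open>p!\<close> only the term \<open>(p - 1)! g(0)\<^sup>p\<close> survives.\<close>

lemma deriv_sum_auxiliary_zero: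
  fixes g :: "int poly" and p :: nat
  assumes "p > 0" "g \<noteq> 0"
  defines "f \<equiv> monom 1 (p - 1) * g ^ p"
  obtains m where "deriv_sum f 0 = of_int (fact (p - 1) * (coeff g 0 ^ p + int p * m))"
proof -
  have deg: "degree f \<ge> p - 1"
    using assms by (simp add: f_def degree_mult_eq degree_monom_eq)
  have coeff: "coeff f j = (if j < p - 1 then 0 else coeff (g ^ p) (j - (p - 1)))" for j
    by (simp add: f_def coeff_monom_mult)
  have "(\<Sum>j\<le>degree f. fact j * coeff f j)
      = fact (p - 1) * coeff f (p - 1) + (\<Sum>j\<in>{..degree f} - {p - 1}. fact j * coeff f j)"
    using deg by (intro sum.remove) auto
  moreover have "fact p dvd (\<Sum>j\<in>{..degree f} - {p - 1}. fact j * coeff f j)"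
  proof (intro dvd_sum)
    fix j assume "j \<in> {..degree f} - {p - 1}"
    \<comment> \<open>Below \<open>p - 1\<close> the monomial makes the coefficients vanish; from
      \<open>p\<close> on \<open>p!\<close> divides \<open>j!\<close>.\<close>
    then consider "j < p - 1" | "p \<le> j" by force
    then show "fact p dvd fact j * coeff f j"
      by cases (simp_all add: coeff fact_dvd)
  qed
  then obtain m where "(\<Sum>j\<in>{..degree f} - {p - 1}. fact j * coeff f j) = fact p * m"
    by (elim dvdE)
  moreover have "(fact p :: int) = int p * fact (p - 1)"
    using \<open>p > 0\<close> by (simp add: fact_reduce)
  moreover have "coeff f (p - 1) = coeff g 0 ^ p"
    by (simp add: coeff coeff_0_power)
  ultimately have "deriv_sum f 0 = of_int (fact (p - 1) * (coeff g 0 ^ p + int p * m))"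
    by (simp only: deriv_sum_zero_eq) (simp add: algebra_simps)
  then show thesis by (rule that)
qed

text \<open>Derivatives of order below \<open>p\<close> still contain a factor \<open>g\<close> and
  vanish at the \<open>\<beta> i\<close>. From order \<open>p\<close> on they are \<open>p!\<close>
  times integer polynomials, and \<open>c ^ degree f\<close> clears the denominators of the
  sums.\<close>

lemma deriv_sum_auxiliary_roots:
  fixes g :: "int poly" and p :: nat and \<beta> :: "'i \<Rightarrow> complex"
  assumes pow: "\<And>n. of_int c ^ n * (\<Sum>i\<in>B. \<beta> i ^ n) \<in> \<int>"
    and root: "\<And>i. i \<in> B \<Longrightarrow> eval_int_poly g (\<beta> i) = 0"
  defines "f \<equiv> monom 1 (p - 1) * g ^ p"
  obtains m where "of_int c ^ degree f * (\<Sum>i\<in>B. deriv_sum f (\<beta> i)) = of_int (fact p * m)"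
proof -
  have "\<exists>m. of_int c ^ degree f * (\<Sum>i\<in>B. eval_int_poly ((pderiv ^^ j) f) (\<beta> i)) = of_int (fact p * m)"
    for j
  proof (cases "p \<le> j")
    case True
    obtain h where h: "(pderiv ^^ j) f = [:fact p:] * h"
      using fact_dvd_higher_pderiv[OF True, of f] by (elim dvdE)
    have "degree h = degree ((pderiv ^^ j) f)"
      by (simp add: h)
    also have "\<dots> \<le> degree f"
      by (simp add: degree_higher_pderiv)
    finally have "of_int c ^ degree f * (\<Sum>i\<in>B. eval_int_poly h (\<beta> i)) \<in> \<int>"
      using power_sum_eval_Ints[OF pow] by blast
    then obtain m where m: "of_int c ^ degree f * (\<Sum>i\<in>B. eval_int_poly h (\<beta> i)) = of_int m"
      by (elim Ints_cases)
    have "eval_int_poly ((pderiv ^^ j) f) x = fact p * eval_int_poly h x" for x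
      by (simp add: h map_poly_smult of_int_hom.map_poly_hom_smult)
    then have "of_int c ^ degree f * (\<Sum>i\<in>B. eval_int_poly ((pderiv ^^ j) f) (\<beta> i))
        = fact p * (of_int c ^ degree f * (\<Sum>i\<in>B. eval_int_poly h (\<beta> i)))"
      by (simp add: sum_distrib_left mult_ac)
    then show ?thesis
      unfolding m by (intro exI[of _ m]) simp
  next
    case False
    have "g ^ (p - j) dvd (pderiv ^^ j) f"
      by (rule power_dvd_higher_pderiv) (simp add: f_def)
    then obtain h where "(pderiv ^^ j) f = g ^ (p - j) * h"
      by (elim dvdE)
    then have "eval_int_poly ((pderiv ^^ j) f) (\<beta> i) = 0" if "i \<in> B" for i
      using root[OF that] False by (simp add: of_int_poly_hom.hom_mult of_int_poly_hom.hom_power)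
    then show ?thesis
      by (intro exI[of _ 0]) simp
  qed
  then obtain m where m: "\<And>j. of_int c ^ degree f * (\<Sum>i\<in>B. eval_int_poly ((pderiv ^^ j) f) (\<beta> i))
      = of_int (fact p * m j)"
    by metis
  have "of_int c ^ degree f * (\<Sum>i\<in>B. deriv_sum f (\<beta> i))
      = of_int c ^ degree f * (\<Sum>j\<le>degree f. \<Sum>i\<in>B. eval_int_poly ((pderiv ^^ j) f) (\<beta> i))"
    unfolding deriv_sum_def by (subst sum.swap) simp
  also have "\<dots> = (\<Sum>j\<le>degree f. of_int (fact p * m j))"
    unfolding m[symmetric] by (rule sum_distrib_left)
  also have "\<dots> = of_int (fact p * (\<Sum>j\<le>degree f. m j))"
    by (simp add: sum_distrib_left)
  finally show thesis by (rule that)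
qed

text \<open>Hermite's contradiction: for a large prime \<open>p\<close> the quantity
  \<open>T\<close> is a nonzero integer multiple of \<open>(p - 1)!\<close>, while the exponential
  relation and \<open>hermite_estimate\<close> force \<open>|T| < (p - 1)!\<close>.\<close>

lemma exp_sum_neq_neg_nat:
  fixes \<beta> :: "'i \<Rightarrow> complex"
  assumes fin: "finite B" and A: "A > 0" and c: "c \<noteq> 0"
    and pow: "\<And>n. of_int c ^ n * (\<Sum>i\<in>B. \<beta> i ^ n) \<in> \<int>"
    and root: "\<And>i. i \<in> B \<Longrightarrow> eval_int_poly g (\<beta> i) = 0" and g0: "coeff g 0 \<noteq> 0"
  shows "(\<Sum>i\<in>B. exp (\<beta> i)) \<noteq> - of_nat A"
proof
  assume exp_sum: "(\<Sum>i\<in>B. exp (\<beta> i)) = - of_nat A"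
  have "g \<noteq> 0" using g0 by auto
  \<comment> \<open>Chosen so that \<open>\<rho> ^ p\<close> dominates
    \<open>|c| ^ degree f\<close>: the degree \<open>p - 1 + p * degree g\<close> is below
    \<open>p * Suc (degree g)\<close>.\<close>
  define \<rho> where "\<rho> = real_of_int \<bar>c\<bar> ^ Suc (degree g)"
  define R where "R i = \<rho> * (cmod (\<beta> i) * poly (abs_poly g) (cmod (\<beta> i)))" for i
  have "(\<lambda>n. \<Sum>i\<in>B. exp (cmod (\<beta> i)) * R i * (R i ^ n / fact n)) \<longlonglongrightarrow> (\<Sum>i\<in>B. exp (cmod (\<beta> i)) * R i * 0)"
    by (intro tendsto_intros power_over_fact_tendsto_0)
  then have "eventually (\<lambda>n. (\<Sum>i\<in>B. exp (cmod (\<beta> i)) * R i * (R i ^ n / fact n)) < 1) sequentially"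
    by (intro order_tendstoD(2)[where y = 0]) auto
  then obtain N where N: "\<And>n. n \<ge> N \<Longrightarrow> (\<Sum>i\<in>B. exp (cmod (\<beta> i)) * R i * (R i ^ n / fact n)) < 1"
    unfolding eventually_sequentially by blast
  \<comment> \<open>Above \<open>Suc N\<close>, so that the bound applies at \<open>p - 1\<close>;
    above \<open>A\<close>, \<open>|c|\<close> and \<open>|g(0)|\<close>, so that \<open>p\<close>
    divides none of them.\<close>
  obtain p where p: "prime p" "p > Suc N + A + nat \<bar>c\<bar> + nat \<bar>coeff g 0\<bar>"
    using bigger_prime by blast
  then have "p > 0" by simp
  define f where "f = monom 1 (p - 1) * g ^ p"
  have deg: "degree f = p - 1 + p * degree g"
    using \<open>g \<noteq> 0\<close> by (simp add: f_def degree_mult_eq degree_monom_eq degree_power_eq)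
  define T where "T = of_int c ^ degree f * (of_nat A * deriv_sum f 0 + (\<Sum>i\<in>B. deriv_sum f (\<beta> i)))"

  obtain m where m: "deriv_sum f 0 = of_int (fact (p - 1) * (coeff g 0 ^ p + int p * m))"
    using deriv_sum_auxiliary_zero[OF \<open>p > 0\<close> \<open>g \<noteq> 0\<close>] unfolding f_def by blast
  obtain m' where m': "of_int c ^ degree f * (\<Sum>i\<in>B. deriv_sum f (\<beta> i)) = of_int (fact p * m')"
    using deriv_sum_auxiliary_roots[OF pow root] unfolding f_def by blast
  define Y where "Y = c ^ degree f * int A * coeff g 0 ^ p + int p * (c ^ degree f * int A * m + m')"
  have "T = of_int c ^ degree f * of_nat A * deriv_sum f 0 + of_int (fact p * m')"
    by (simp add: T_def ring_distribs m')
  also have "\<dots> = of_int (fact (p - 1) * Y)"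
    unfolding m Y_def using fact_reduce[OF \<open>p > 0\<close>, where 'a = complex]
    by (simp add: algebra_simps)
  finally have T: "T = of_int (fact (p - 1) * Y)" .
  \<comment> \<open>Modulo \<open>p\<close> only \<open>c ^ degree f * A * g(0) ^ p\<close> is left
    of \<open>Y\<close>.\<close>
  have "Y \<noteq> 0"
  proof
    assume "Y = 0"
    then have "int p dvd c ^ degree f * int A * coeff g 0 ^ p"
      unfolding Y_def by (metis dvd_add_left_iff dvd_triv_left dvd_0_right)
    moreover have "prime (int p)" using p by simp
    ultimately have "int p dvd c \<or> int p dvd int A \<or> int p dvd coeff g 0"
      by (metis prime_dvd_mult_iff prime_dvd_power)
    then have "int p \<le> \<bar>c\<bar> \<or> int p \<le> int A \<or> int p \<le> \<bar>coeff g 0\<bar>"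
      using A c g0 dvd_imp_le_int[of c "int p"] dvd_imp_le_int[of "int A" "int p"]
        dvd_imp_le_int[of "coeff g 0" "int p"] by auto
    then show False
      using p(2) by linarith
  qed
  then have "1 \<le> \<bar>real_of_int Y\<bar>"
    by linarith
  then have "fact (p - 1) \<le> fact (p - 1) * \<bar>real_of_int Y\<bar>"
    by simp
  also have "\<dots> = cmod T"
    unfolding T norm_of_int by (simp add: abs_mult)
  finally have lower: "fact (p - 1) \<le> cmod T" .

  \<comment> \<open>Replacing \<open>A\<close> by the negated exponential sum expresses
    \<open>T\<close> through the differences bounded by \<open>hermite_estimate\<close>.\<close>
  have "T = - (of_int c ^ degree f * (\<Sum>i\<in>B. exp (\<beta> i) * deriv_sum f 0 - deriv_sum f (\<beta> i)))"
    unfolding T_def by (simp add: sum_subtractf exp_sum flip: sum_distrib_right) (simp add: algebra_simps)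
  then have "cmod T = real_of_int \<bar>c\<bar> ^ degree f * cmod (\<Sum>i\<in>B. exp (\<beta> i) * deriv_sum f 0 - deriv_sum f (\<beta> i))"
    by (simp add: norm_mult norm_power)
  also have "\<dots> \<le> \<rho> ^ p * (\<Sum>i\<in>B. exp (cmod (\<beta> i)) * (cmod (\<beta> i) * poly (abs_poly g) (cmod (\<beta> i))) ^ p)"
  proof (intro mult_mono sum_norm_le)
    have "real_of_int \<bar>c\<bar> ^ degree f \<le> real_of_int \<bar>c\<bar> ^ (Suc (degree g) * p)"
      using c by (intro power_increasing) (auto simp: deg)
    then show "real_of_int \<bar>c\<bar> ^ degree f \<le> \<rho> ^ p"
      unfolding \<rho>_def by (simp only: power_mult)
    fix i
    let ?x = "cmod (\<beta> i)"
    have "poly (abs_poly f) ?x \<le> poly (abs_poly (monom 1 (p - 1))) ?x * poly (abs_poly (g ^ p)) ?x"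
      unfolding f_def by (rule abs_poly_mult_le) simp
    also have "abs_poly (monom 1 (p - 1)) = monom 1 (p - 1)"
      by (simp add: map_poly_monom)
    also have "poly (monom 1 (p - 1)) ?x * poly (abs_poly (g ^ p)) ?x \<le> ?x ^ (p - 1) * poly (abs_poly g) ?x ^ p"
      by (auto simp: poly_monom intro!: mult_left_mono abs_poly_power_le)
    finally have "exp ?x * ?x * poly (abs_poly f) ?x \<le> exp ?x * ?x * (?x ^ (p - 1) * poly (abs_poly g) ?x ^ p)"
      by (intro mult_left_mono) auto
    also have "\<dots> = exp ?x * (?x * poly (abs_poly g) ?x) ^ p"
      using \<open>p > 0\<close> by (cases p) (simp_all add: power_mult_distrib mult_ac)
    finally show "cmod (exp (\<beta> i) * deriv_sum f 0 - deriv_sum f (\<beta> i)) \<le> exp ?x * (?x * poly (abs_poly g) ?x) ^ p"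
      using hermite_estimate[of "\<beta> i" f] by linarith
  qed (auto simp: \<rho>_def intro!: sum_nonneg mult_nonneg_nonneg abs_poly_nonneg)
  also have "\<dots> = (\<Sum>i\<in>B. exp (cmod (\<beta> i)) * R i ^ p)"
    by (simp add: R_def sum_distrib_left power_mult_distrib mult_ac)
  also have "\<dots> = fact (p - 1) * (\<Sum>i\<in>B. exp (cmod (\<beta> i)) * R i * (R i ^ (p - 1) / fact (p - 1)))"
    using \<open>p > 0\<close> by (cases p) (simp_all add: sum_distrib_left mult_ac)
  also have "\<dots> < fact (p - 1) * 1"
    using N[of "p - 1"] p by (intro mult_strict_left_mono) auto
  finally show False
    using lower by simp
qed

text \<open>Expanding the vanishing product of the \<open>1 + exp (a j)\<close> over subsets gives
  exponentials of subset sums. The subset sums equal to 0 contribute a positive integer, and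
  \<open>exp_sum_neq_neg_nat\<close> applies to the others.\<close>

theorem pi_i_transcendental: "\<not> algebraic (of_real pi * \<i>)"
proof
  assume "algebraic (of_real pi * \<i>)"
  then obtain P where P: "P \<noteq> 0" "eval_int_poly P (of_real pi * \<i>) = 0"
    by (erule algebraicE')
  define Q :: "complex poly" where "Q = map_poly of_int P"
  define c where "c = lead_coeff P"
  have "c \<noteq> 0" using P by (simp add: c_def)
  have lcQ: "lead_coeff Q = of_int c"
    by (simp add: Q_def c_def degree_map_poly coeff_map_poly)
  obtain as where as: "Polynomial.smult (lead_coeff Q) (\<Prod>a\<leftarrow>as. [:- a, 1:]) = Q"
    using fundamental_theorem_algebra_factorized[of Q] by blast
  define I where "I = {..<length as}"
  define a where "a j = as ! j" for j
  have Q: "Q = Polynomial.smult (of_int c) (\<Prod>j\<in>I. [:- a j, 1:])"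
    unfolding lcQ[symmetric] using as
    by (simp add: prod.list_conv_set_nth I_def a_def lessThan_atLeast0)
  have fin: "finite I" by (simp add: I_def)
  have rat: "coeff (\<Prod>j\<in>I. [:- a j, 1:]) n \<in> \<rat>" for n
  proof -
    have "coeff (\<Prod>j\<in>I. [:- a j, 1:]) n = of_int (coeff P n) / of_int c"
      using arg_cong[OF Q, of "\<lambda>q. coeff q n"] \<open>c \<noteq> 0\<close> by (simp add: Q_def coeff_map_poly)
    then show ?thesis by simp
  qed
  have alg: "algebraic_int (of_int c * a j)" if "j \<in> I" for j
  proof -
    have "poly Q (a j) = 0"
      using that fin by (auto simp: Q poly_prod)
    then show ?thesis
      unfolding c_def using P by (intro algebraic_int_lead_coeff_mult) (simp_all add: Q_def)
  qed
  have alg_sum: "algebraic_int (of_int c * sum a S)" if "S \<subseteq> I" for S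
    unfolding sum_distrib_left using that alg by (intro algebraic_int_sum) auto
  \<comment> \<open>Only nonzero sums are kept, so that a polynomial vanishing at them can have a
    nonzero constant term. The empty set is among the rest, so their number is positive.\<close>
  define B where "B = {S \<in> Pow I. sum a S \<noteq> 0}"
  have finB: "finite B" using fin by (simp add: B_def)
  have "(\<Prod>j\<in>I. 1 + exp (a j)) = 0"
  proof -
    have "poly Q (of_real pi * \<i>) = 0" using P by (simp add: Q_def)
    then obtain j where j: "j \<in> I" "of_real pi * \<i> = a j"
      using fin \<open>c \<noteq> 0\<close> by (auto simp: Q poly_prod)
    have "exp (a j) = -1"
      unfolding j(2)[symmetric] by (rule exp_pi_i)
    then show ?thesis
      using fin j by (intro prod_zero bexI[of _ j]) simp_all
  qed
  moreover have "(\<Prod>j\<in>I. 1 + exp (a j)) = (\<Sum>S\<in>Pow I. exp (sum a S))"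
    using prod_add[OF fin, of "\<lambda>j. exp (a j)" "\<lambda>_. 1"] fin
    by (simp add: add.commute exp_sum finite_subset)
  moreover have "(\<Sum>S\<in>Pow I. exp (sum a S)) = (\<Sum>S\<in>B. exp (sum a S)) + (\<Sum>S\<in>Pow I - B. exp (sum a S))"
    using fin by (subst add.commute, intro sum.subset_diff) (auto simp: B_def)
  moreover have "(\<Sum>S\<in>Pow I - B. exp (sum a S)) = (\<Sum>S\<in>Pow I - B. 1)"
    by (intro sum.cong) (auto simp: B_def)
  ultimately have exp_sum: "(\<Sum>S\<in>B. exp (sum a S)) = - of_nat (card (Pow I - B))"
    by (simp add: add_eq_0_iff2)
  have pos: "card (Pow I - B) > 0"
    using fin by (auto simp: card_gt_0_iff B_def intro!: exI[of _ "{}"])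
  \<comment> \<open>Rational by symmetry in the conjugates, and an algebraic integer because
    \<open>c\<close> clears the denominators. Adding the zero sums changes nothing for
    \<open>n > 0\<close>; \<open>n = 0\<close> only counts \<open>B\<close>.\<close>
  have pow: "of_int c ^ n * (\<Sum>S\<in>B. sum a S ^ n) \<in> \<int>" for n
  proof (cases "n = 0")
    case False
    have "(\<Sum>S\<in>B. sum a S ^ n) = (\<Sum>S\<in>Pow I. sum a S ^ n)"
      using fin False by (intro sum.mono_neutral_left) (auto simp: B_def)
    then have "of_int c ^ n * (\<Sum>S\<in>B. sum a S ^ n) \<in> \<rat>"
      using subset_sum_power_sum_Rats[OF fin rat] by (intro Rats_mult) auto
    moreover have "algebraic_int (\<Sum>S\<in>B. (of_int c * sum a S) ^ n)"
      by (intro algebraic_int_sum algebraic_int_power alg_sum) (auto simp: B_def)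
    then have "algebraic_int (of_int c ^ n * (\<Sum>S\<in>B. sum a S ^ n))"
      by (simp only: power_mult_distrib sum_distrib_left[symmetric])
    ultimately show ?thesis
      by (intro rational_algebraic_int_is_int)
  qed simp
  \<comment> \<open>A polynomial for the nonzero number \<open>c * sum a S\<close>, composed with
    \<open>c * X\<close>, keeps its nonzero constant term.\<close>
  have "\<exists>g. eval_int_poly g (sum a S) = 0 \<and> coeff g 0 \<noteq> 0" if "S \<in> B" for S
  proof -
    have "algebraic (of_int c * sum a S)" "of_int c * sum a S \<noteq> 0"
      using that alg_sum \<open>c \<noteq> 0\<close> by (auto simp: B_def)
    then obtain h where h: "coeff h 0 \<noteq> 0" "eval_int_poly h (of_int c * sum a S) = 0"
      by (rule algebraicE'_nonzero)
    have "map_poly of_int [:0, c:] = [:0, of_int c :: complex:]"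
      by (rule poly_eqI) (simp add: coeff_map_poly coeff_pCons split: nat.split)
    note lin = this
    show ?thesis
    proof (intro exI conjI)
      show "eval_int_poly (pcompose h [:0, c:]) (sum a S) = 0"
        using h by (simp add: of_int_hom.map_poly_pcompose poly_pcompose lin mult.commute)
      show "coeff (pcompose h [:0, c:]) 0 \<noteq> 0"
        using h by (simp flip: poly_0_coeff_0 add: poly_pcompose)
    qed
  qed
  then obtain g where g: "\<And>S. S \<in> B \<Longrightarrow> eval_int_poly (g S) (sum a S) = 0"
    "\<And>S. S \<in> B \<Longrightarrow> coeff (g S) 0 \<noteq> 0"
    by metis
  have "eval_int_poly (prod g B) (sum a S) = 0" if "S \<in> B" for S
    using g(1) that finB by (auto simp: of_int_poly_hom.hom_prod poly_prod)
  moreover have "coeff (prod g B) 0 \<noteq> 0"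
    using g(2) finB by (simp flip: poly_0_coeff_0 add: poly_prod)
  ultimately show False
    using exp_sum_neq_neg_nat[OF finB pos \<open>c \<noteq> 0\<close> pow] exp_sum by blast
qed

section \<open>Polynomials over a subfield of the complex numbers\<close>

text \<open>Subfields in terms of type class arithmetic, so that the usual polynomials can be used.
  \<open>inverse_closed\<close> includes 0 because \<open>inverse 0 = 0\<close>.\<close>

locale complex_subfield =
  fixes K :: "complex set"
  assumes one_closed: "1 \<in> K"
    and add_closed: "x \<in> K \<Longrightarrow> y \<in> K \<Longrightarrow> x + y \<in> K"
    and uminus_closed: "x \<in> K \<Longrightarrow> - x \<in> K"
    and mult_closed: "x \<in> K \<Longrightarrow> y \<in> K \<Longrightarrow> x * y \<in> K"
    and inverse_closed: "x \<in> K \<Longrightarrow> inverse x \<in> K"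
begin

lemma zero_closed: "0 \<in> K"
  using add_closed[OF one_closed uminus_closed[OF one_closed]] by simp

lemma diff_closed: "x \<in> K \<Longrightarrow> y \<in> K \<Longrightarrow> x - y \<in> K"
  using add_closed[OF _ uminus_closed, of x y] by simp

lemma divide_closed: "x \<in> K \<Longrightarrow> y \<in> K \<Longrightarrow> x / y \<in> K"
  using mult_closed[OF _ inverse_closed, of x y] by (simp add: field_simps)

lemma power_closed: "x \<in> K \<Longrightarrow> x ^ n \<in> K"
  by (induction n) (simp_all add: one_closed mult_closed)

lemma sum_closed: "(\<And>i. i \<in> I \<Longrightarrow> f i \<in> K) \<Longrightarrow> sum f I \<in> K"
  by (induction I rule: infinite_finite_induct) (simp_all add: zero_closed add_closed)

lemma of_nat_closed: "of_nat n \<in> K"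
  by (induction n) (simp_all add: zero_closed one_closed add_closed)

lemma of_int_closed: "of_int n \<in> K"
  by (cases n rule: int_cases2) (simp_all add: of_nat_closed uminus_closed)

lemma Rats_closed: "x \<in> \<rat> \<Longrightarrow> x \<in> K"
  by (elim Rats_cases') (simp add: divide_closed of_int_closed)

definition polys :: "complex poly set" where
  "polys = {p. \<forall>i. coeff p i \<in> K}"

lemma polysI: "(\<And>i. coeff p i \<in> K) \<Longrightarrow> p \<in> polys"
  by (simp add: polys_def)

lemma polys_coeff: "p \<in> polys \<Longrightarrow> coeff p i \<in> K"
  by (simp add: polys_def)

lemma polys_add: "p \<in> polys \<Longrightarrow> r \<in> polys \<Longrightarrow> p + r \<in> polys"
  by (simp add: polys_def add_closed)

lemma polys_diff: "p \<in> polys \<Longrightarrow> r \<in> polys \<Longrightarrow> p - r \<in> polys"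
  by (simp add: polys_def diff_closed)

lemma polys_mult: "p \<in> polys \<Longrightarrow> r \<in> polys \<Longrightarrow> p * r \<in> polys"
  by (simp add: polys_def coeff_mult sum_closed mult_closed)

lemma polys_smult: "c \<in> K \<Longrightarrow> p \<in> polys \<Longrightarrow> Polynomial.smult c p \<in> polys"
  by (simp add: polys_def mult_closed)

lemma polys_pCons: "c \<in> K \<Longrightarrow> p \<in> polys \<Longrightarrow> pCons c p \<in> polys"
  by (simp add: polys_def coeff_pCons split: nat.split)

lemma polys_zero: "0 \<in> polys"
  by (simp add: polys_def zero_closed)

lemma polys_one: "1 \<in> polys"
  unfolding one_pCons by (intro polys_pCons one_closed polys_zero)

lemma polys_power: "p \<in> polys \<Longrightarrow> p ^ n \<in> polys"
  by (induction n) (simp_all add: polys_one polys_mult)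

lemma polys_monom: "c \<in> K \<Longrightarrow> monom c n \<in> polys"
  by (simp add: polys_def zero_closed)

lemma poly_closed: "p \<in> polys \<Longrightarrow> x \<in> K \<Longrightarrow> poly p x \<in> K"
  by (simp add: poly_altdef sum_closed mult_closed power_closed polys_coeff)

text \<open>Adding the value at \<open>- x\<close> cancels the odd powers and leaves powers of
  \<open>x\<^sup>2\<close>. This serves even \<open>k\<close>, where only the square of the
  cotangent value is known to lie in \<open>K\<close>.\<close>

lemma poly_even_closed:
  assumes "p \<in> polys" "x\<^sup>2 \<in> K" "poly p (- x) = poly p x"
  shows "poly p x \<in> K"
proof -
  have "x ^ n + (- x) ^ n \<in> K" for n
  proof (cases "even n")
    case True
    then have "x ^ n + (- x) ^ n = 2 * (x\<^sup>2) ^ (n div 2)"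
      by (simp flip: power_mult)
    then show ?thesis
      using mult_closed[OF of_nat_closed[of 2] power_closed[OF assms(2)]] by simp
  qed (simp add: zero_closed)
  then have "(\<Sum>n\<le>degree p. coeff p n * (x ^ n + (- x) ^ n)) \<in> K"
    by (intro sum_closed mult_closed polys_coeff assms)
  also have "(\<Sum>n\<le>degree p. coeff p n * (x ^ n + (- x) ^ n)) = poly p x + poly p (- x)"
    by (simp add: poly_altdef sum.distrib distrib_left)
  finally have "(poly p x + poly p (- x)) / of_nat 2 \<in> K"
    by (intro divide_closed of_nat_closed)
  then show ?thesis
    using assms(3) by simp
qed

text \<open>A nonzero element of least degree in the ideal generated over \<open>K\<close> divides
  every element. The Bezout representation is kept because it transfers common roots to
  \<open>G\<close>.\<close>

lemma ex_polys_gcd: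
  assumes A: "A \<in> polys" "A \<noteq> 0" and B: "B \<in> polys"
  obtains G u v where "G \<in> polys" "G \<noteq> 0" "G dvd A" "G dvd B" "G = u * A + v * B"
proof -
  define J where "J = {u * A + v * B | u v. u \<in> polys \<and> v \<in> polys}"
  have JI: "P \<in> J" if "P = u * A + v * B" "u \<in> polys" "v \<in> polys" for P u v
    using that unfolding J_def by auto
  have AJ: "A \<in> J" by (rule JI[of _ 1 0]) (simp_all add: polys_zero polys_one)
  have BJ: "B \<in> J" by (rule JI[of _ 0 1]) (simp_all add: polys_zero polys_one)
  have J_polys: "P \<in> polys" if "P \<in> J" for P
    using that A B unfolding J_def by (auto intro!: polys_add polys_mult)
  obtain G where G: "G \<in> J" "G \<noteq> 0" and min: "\<And>P. P \<in> J \<Longrightarrow> P \<noteq> 0 \<Longrightarrow> degree G \<le> degree P"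
    using ex_has_least_nat[of "\<lambda>P. P \<in> J \<and> P \<noteq> 0" A degree] AJ A(2) by blast
  have dvd: "G dvd P" if "P \<in> J" for P
    using that
  proof (induction "degree P" arbitrary: P rule: less_induct)
    case less
    show ?case
    proof (cases "P = 0")
      case False
      \<comment> \<open>\<open>M * G\<close> cancels the leading term of \<open>P\<close>, so the
        induction hypothesis applies to the difference, which stays in the ideal.\<close>
      define M where "M = monom (lead_coeff P / lead_coeff G) (degree P - degree G)"
      have M: "M \<in> polys"
        unfolding M_def using less.prems G
        by (intro polys_monom divide_closed polys_coeff J_polys)
      have "lead_coeff P / lead_coeff G \<noteq> 0"
        using False G by simp
      then have deg: "degree (M * G) = degree P"
        using G min[OF less.prems False] unfolding M_def
        by (subst degree_mult_eq) (auto simp: degree_monom_eq)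
      have "lead_coeff (M * G) = lead_coeff P"
        using G \<open>lead_coeff P / lead_coeff G \<noteq> 0\<close>
        by (simp add: lead_coeff_mult M_def degree_monom_eq)
      then have coeff: "coeff (P - M * G) (degree P) = 0"
        by (simp add: deg)
      obtain u v where "P = u * A + v * B" "u \<in> polys" "v \<in> polys"
        using less.prems unfolding J_def by blast
      moreover obtain u' v' where "G = u' * A + v' * B" "u' \<in> polys" "v' \<in> polys"
        using G unfolding J_def by blast
      ultimately have "P - M * G \<in> J"
        using M by (intro JI[of _ "u - M * u'" "v - M * v'"])
          (simp_all add: algebra_simps polys_diff polys_mult)
      moreover have "degree (P - M * G) < degree P \<or> P - M * G = 0"
      proof (cases "degree (P - M * G) = degree P")
        case True
        then have "lead_coeff (P - M * G) = 0"
          by (simp only: True coeff)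
        then show ?thesis
          by (simp only: leading_coeff_0_iff simp_thms)
      next
        case False
        then show ?thesis
          using degree_diff_le_max[of P "M * G"] deg by simp
      qed
      ultimately have "G dvd P - M * G"
        using less.hyps by auto
      then show ?thesis
        by (simp add: dvd_diff_left_iff)
    qed simp
  qed
  obtain u v where "G = u * A + v * B"
    using G unfolding J_def by blast
  then show thesis
    using that[of G u v] G J_polys dvd AJ BJ by blast
qed

end

lemma prod_linear_dvd:
  fixes p :: "'a :: idom poly"
  assumes "finite S" "\<And>r. r \<in> S \<Longrightarrow> poly p r = 0"
  shows "(\<Prod>r\<in>S. [:- r, 1:]) dvd p"
  using assms
proof (induction S rule: finite_induct)
  case (insert s S)
  then obtain u where u: "p = (\<Prod>r\<in>S. [:- r, 1:]) * u"
    by (auto elim: dvdE)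
  have "poly (\<Prod>r\<in>S. [:- r, 1:]) s \<noteq> 0"
    using insert by (auto simp: poly_prod)
  then have "poly u s = 0"
    using insert.prems[of s] u by simp
  then obtain t where t: "u = [:- s, 1:] * t"
    unfolding poly_eq_0_iff_dvd by (elim dvdE)
  have "p = (\<Prod>r\<in>insert s S. [:- r, 1:]) * t"
    unfolding u t prod.insert[OF insert.hyps] by (simp only: mult_ac)
  then show ?case
    by (rule dvdI)
qed simp

context complex_subfield
begin

text \<open>The product over the common roots is, up to a scalar, the gcd over \<open>K\<close>.\<close>

lemma polys_common_roots:
  assumes fin: "finite S" and A: "(\<Prod>r\<in>S. [:- r, 1:]) \<in> polys" and B: "B \<in> polys"
  shows "(\<Prod>r\<in>{r \<in> S. poly B r = 0}. [:- r, 1:]) \<in> polys"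
proof -
  define P where "P S = (\<Prod>r\<in>S. [:- r, 1:])" for S :: "complex set"
  define T where "T = {r \<in> S. poly B r = 0}"
  have P_nz: "P S' \<noteq> 0" for S'
    by (cases "finite S'") (auto simp: P_def)
  have finT: "finite T" "finite (S - T)" using fin by (auto simp: T_def)
  have split: "P S = P T * P (S - T)"
    unfolding P_def using fin by (subst mult.commute, intro prod.subset_diff) (auto simp: T_def)
  obtain G u v where G: "G \<in> polys" "G \<noteq> 0" "G dvd P S" "G dvd B" "G = u * P S + v * B"
    using ex_polys_gcd[of "P S" B] A B P_nz unfolding P_def by metis
  \<comment> \<open>Bezout hands the common roots to \<open>G\<close>. Since \<open>G\<close>
    divides \<open>B\<close>, it has no root in \<open>S - T\<close>, so \<open>P (S - T)\<close>
    divides the cofactor \<open>C\<close>. Comparison with \<open>P S\<close> leaves only a unit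
    \<open>F\<close>.\<close>
  have "P T dvd G"
    unfolding P_def G(5) using fin by (intro prod_linear_dvd finT) (auto simp: T_def poly_prod P_def)
  then obtain F where F: "G = P T * F" by (elim dvdE)
  obtain C where C: "P S = G * C" using G(3) by (elim dvdE)
  have "poly C r = 0" if "r \<in> S - T" for r
  proof -
    have "poly B r \<noteq> 0" using that by (simp add: T_def)
    then have "poly G r \<noteq> 0" using G(4) by (auto elim: dvdE)
    moreover have "poly (P S) r = 0" using that fin by (auto simp: P_def poly_prod)
    ultimately show ?thesis using C by simp
  qed
  then have "P (S - T) dvd C"
    unfolding P_def by (intro prod_linear_dvd finT)
  then obtain E where E: "C = P (S - T) * E" by (elim dvdE)
  have "P S * 1 = P S * (F * E)"
    using C E F split by (simp add: mult_ac)
  then have "F * E = 1"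
    using P_nz[of S] by (metis mult_left_cancel)
  then have "F dvd 1" by (metis dvd_triv_left)
  then have "F \<noteq> 0" "degree F = 0"
    by auto
  then obtain c where c: "F = [:c:]" "c \<noteq> 0"
    by (metis degree_eq_zeroE pCons_0_0)
  \<comment> \<open>As \<open>P T\<close> is monic, the unit is the leading coefficient of
    \<open>G\<close> and lies in \<open>K\<close>.\<close>
  have "lead_coeff (P T) = 1"
    by (simp add: P_def lead_coeff_prod)
  then have "lead_coeff G = c"
    using c by (simp add: F)
  then have "c \<in> K"
    using polys_coeff[OF G(1)] by blast
  then have "Polynomial.smult (inverse c) G \<in> polys"
    by (intro polys_smult inverse_closed G)
  also have "Polynomial.smult (inverse c) G = P T"
    using c by (simp add: F)
  finally show ?thesis
    by (simp add: P_def T_def)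
qed

end

lemma complex_subfield_if_subfield:
  assumes "subfield K complex_field"
  shows "complex_subfield K"
proof -
  interpret F: field complex_field
    by (rule field_from_type_algebra)
  have inv: "inv\<^bsub>complex_field\<^esub> x = inverse x" if "x \<noteq> 0" for x :: complex
    by (rule F.inv_char) (use that in \<open>auto simp: ring_of_type_algebra_def\<close>)
  have neg: "\<ominus>\<^bsub>complex_field\<^esub> x = - x" for x :: complex
    by (rule F.minus_equality) (auto simp: ring_of_type_algebra_def)
  have ring: "subring K complex_field"
    using assms by (rule subfieldE(1))
  show ?thesis
  proof
    show "1 \<in> K"
      using subringE(3)[OF ring] by (simp add: ring_of_type_algebra_def)
    fix x y
    assume x: "x \<in> K"
    show "- x \<in> K"
      using subringE(5)[OF ring x] by (simp add: neg)
    show "inverse x \<in> K"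
    proof (cases "x = 0")
      case False
      then have "inv\<^bsub>complex_field\<^esub> x \<in> K"
        using F.subfield_m_inv(1)[OF assms, of x] x by (simp add: ring_of_type_algebra_def)
      then show ?thesis using inv[OF False] by simp
    qed (use x in simp)
    assume y: "y \<in> K"
    show "x + y \<in> K" "x * y \<in> K"
      using subringE(6,7)[OF ring x y] by (simp_all add: ring_of_type_algebra_def)
  qed
qed

section \<open>Reflection formula and cotangent polynomials\<close>

text \<open>\<open>icot z = - \<i> cot (\<pi> z)\<close> for \<open>z\<close> not an integer.\<close>

definition icot :: "complex \<Rightarrow> complex" where
  "icot z = (exp (2 * of_real pi * \<i> * z) + 1) / (exp (2 * of_real pi * \<i> * z) - 1)"

text \<open>The recursion reflects \<open>icot' = \<pi> \<i> (1 - icot\<^sup>2)\<close>.\<close>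

primrec cot_poly :: "nat \<Rightarrow> complex poly" where
  "cot_poly 0 = [:0, 1:]"
| "cot_poly (Suc m) = [:1, 0, -1:] * pderiv (cot_poly m)"

lemma exp_2pi_i_neq_1:
  assumes "z \<notin> \<int>"
  shows "exp (2 * of_real pi * \<i> * z) \<noteq> 1"
proof
  assume "exp (2 * of_real pi * \<i> * z) = 1"
  then obtain n :: int where "Im z = 0" "Re z = of_int n"
    by (auto simp: exp_eq_1)
  then have "z = of_int n"
    by (simp add: complex_eq_iff)
  with assms show False by simp
qed

lemma has_field_derivative_icot:
  assumes "z \<notin> \<int>"
  shows "(icot has_field_derivative of_real pi * \<i> * (1 - (icot z)\<^sup>2)) (at z)"
proof -
  define E where "E = exp (2 * of_real pi * \<i> * z)"
  have E: "E - 1 \<noteq> 0"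
    using exp_2pi_i_neq_1[OF assms] by (simp add: E_def)
  have "(icot has_field_derivative
      (2 * of_real pi * \<i> * E * (E - 1) - (E + 1) * (2 * of_real pi * \<i> * E)) / ((E - 1) * (E - 1))) (at z)"
    unfolding icot_def[abs_def] using E unfolding E_def
    by (auto intro!: derivative_eq_intros)
  also have "(2 * of_real pi * \<i> * E * (E - 1) - (E + 1) * (2 * of_real pi * \<i> * E)) / ((E - 1) * (E - 1))
      = of_real pi * \<i> * (1 - ((E + 1) / (E - 1))\<^sup>2)"
  proof -
    have "(2 * c * (d + 1) * d - (d + 2) * (2 * c * (d + 1))) / (d * d) = c * (1 - ((d + 2) / d)\<^sup>2)"
      if "d \<noteq> 0" for c d :: complex
    proof -
      have "2 * c * (d + 1) * d - (d + 2) * (2 * c * (d + 1)) = c * (d * d - (d + 2) * (d + 2))"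
        by (simp add: algebra_simps)
      then show ?thesis
        using that by (simp only:) (simp add: diff_divide_distrib power2_eq_square right_diff_distrib)
    qed
    from this[of "E - 1" "of_real pi * \<i>"] E show ?thesis
      by (simp add: mult.assoc add.commute[of E 1])
  qed
  also have "(E + 1) / (E - 1) = icot z"
    by (simp add: icot_def E_def)
  finally show ?thesis .
qed

text \<open>Logarithmic differentiation of the reflection formula, for \<open>rGamma\<close> because
  it has no poles, compared with the derivative of the sine.\<close>

lemma Digamma_reflection_icot:
  assumes "z \<notin> \<int>"
  shows "Digamma z - Digamma (1 - z) = - of_real pi * \<i> * icot z"
proof -
  have z: "z \<notin> \<int>\<^sub>\<le>\<^sub>0" "1 - z \<notin> \<int>\<^sub>\<le>\<^sub>0"
    using assms by (auto dest: nonpos_Ints_Int simp: minus_in_Ints_iff Ints_diff)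
  have eq: "rGamma z * rGamma (1 - z) = sin (of_real pi * z) / of_real pi" for z :: complex
    by (rule rGamma_reflection_complex)
  have "((\<lambda>z. rGamma z * rGamma (1 - z)) has_field_derivative
      (- rGamma z * Digamma z) * rGamma (1 - z) + rGamma z * (rGamma (1 - z) * Digamma (1 - z))) (at z)"
    using z by (auto intro!: derivative_eq_intros)
  also have "(- rGamma z * Digamma z) * rGamma (1 - z) + rGamma z * (rGamma (1 - z) * Digamma (1 - z))
      = (Digamma (1 - z) - Digamma z) * (rGamma z * rGamma (1 - z))"
    by (simp add: algebra_simps)
  finally have "((\<lambda>z. sin (of_real pi * z) / of_real pi) has_field_derivative
      (Digamma (1 - z) - Digamma z) * (sin (of_real pi * z) / of_real pi)) (at z)"
    unfolding eq .
  moreover have "((\<lambda>z. sin (of_real pi * z) / of_real pi) has_field_derivative cos (of_real pi * z)) (at z)"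
    by (auto intro!: derivative_eq_intros)
  ultimately have eq': "(Digamma (1 - z) - Digamma z) * (sin (of_real pi * z) / of_real pi) = cos (of_real pi * z)"
    by (rule DERIV_unique)
  \<comment> \<open>The exponential of half the angle: sine and cosine are Laurent polynomials in
    \<open>W\<close>, and \<open>icot\<close> is a function of its square.\<close>
  define W where "W = exp (\<i> * (of_real pi * z))"
  have W: "W \<noteq> 0" "exp (- (\<i> * (of_real pi * z))) = 1 / W"
    by (simp_all add: W_def exp_minus field_simps)
  have W2: "exp (2 * of_real pi * \<i> * z) = W\<^sup>2"
    by (simp add: W_def power2_eq_square flip: exp_add) (simp add: algebra_simps)
  have "W\<^sup>2 - 1 \<noteq> 0"
    using exp_2pi_i_neq_1[OF assms] by (simp add: W2)
  have sin: "sin (of_real pi * z) = (W - 1 / W) / (2 * \<i>)"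
    by (simp only: sin_exp_eq W_def[symmetric] W(2))
  have cos: "cos (of_real pi * z) = (W + 1 / W) / 2"
    by (simp only: cos_exp_eq W_def[symmetric] W(2))
  have "(Digamma (1 - z) - Digamma z) * (W - 1 / W)
      = (Digamma (1 - z) - Digamma z) * (sin (of_real pi * z) / of_real pi) * (2 * \<i> * of_real pi)"
  proof -
    have cancel: "y / b * b = y" if "b \<noteq> 0" for y b :: complex
      using that by simp
    show ?thesis
      unfolding sin divide_divide_eq_left mult.assoc[of "_ - _"] by (subst cancel) simp_all
  qed
  also have "\<dots> = of_real pi * \<i> * (W + 1 / W)"
    by (simp only: eq' cos) simp
  finally have "(Digamma (1 - z) - Digamma z) * (W - 1 / W) * W = of_real pi * \<i> * (W + 1 / W) * W"
    by (simp only:)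
  then have "(Digamma (1 - z) - Digamma z) * (W\<^sup>2 - 1) = of_real pi * \<i> * (W\<^sup>2 + 1)"
    using W(1) by (simp only: mult.assoc left_diff_distrib[of W] distrib_right[of W])
      (simp add: power2_eq_square)
  then have "Digamma (1 - z) - Digamma z = of_real pi * \<i> * icot z"
    using \<open>W\<^sup>2 - 1 \<noteq> 0\<close> by (simp add: icot_def W2 eq_divide_eq)
  then show ?thesis
    by (simp add: algebra_simps)
qed

text \<open>The digamma reflection differentiated \<open>m\<close> times: the inner
  \<open>1 - z\<close> brings the sign, each derivative of \<open>icot\<close> one more
  \<open>\<pi> \<i>\<close> and the factor \<open>1 - icot\<^sup>2\<close> of the recursion.\<close>

lemma Polygamma_reflection_cot_poly:
  assumes "z \<notin> \<int>"
  shows "Polygamma m z - (-1) ^ m * Polygamma m (1 - z)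
           = - ((of_real pi * \<i>) ^ Suc m * poly (cot_poly m) (icot z))"
  using assms
proof (induction m arbitrary: z)
  case 0
  then show ?case
    using Digamma_reflection_icot[of z] by simp
next
  case (Suc m)
  have z: "z \<notin> \<int>\<^sub>\<le>\<^sub>0" "1 - z \<notin> \<int>\<^sub>\<le>\<^sub>0"
    using Suc.prems by (auto dest: nonpos_Ints_Int simp: minus_in_Ints_iff Ints_diff)
  have "((\<lambda>z. Polygamma m z - (-1) ^ m * Polygamma m (1 - z)) has_field_derivative
      Polygamma (Suc m) z - (-1) ^ Suc m * Polygamma (Suc m) (1 - z)) (at z)"
    using z by (auto intro!: derivative_eq_intros)
  \<comment> \<open>The induction hypothesis holds on the whole open complement of the integers, so
    it may be differentiated.\<close>
  then have "((\<lambda>z. - ((of_real pi * \<i>) ^ Suc m * poly (cot_poly m) (icot z))) has_field_derivative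
      Polygamma (Suc m) z - (-1) ^ Suc m * Polygamma (Suc m) (1 - z)) (at z)"
    by (rule has_field_derivative_transform_within_open[where S = "- \<int>"])
      (use Suc closed_Ints[where 'a = complex] in auto)
  moreover have "((\<lambda>z. - ((of_real pi * \<i>) ^ Suc m * poly (cot_poly m) (icot z))) has_field_derivative
      - ((of_real pi * \<i>) ^ Suc m * (poly (pderiv (cot_poly m)) (icot z) * (of_real pi * \<i> * (1 - (icot z)\<^sup>2))))) (at z)"
    by (intro DERIV_minus DERIV_cmult DERIV_chain2[OF poly_DERIV] has_field_derivative_icot Suc.prems)
  ultimately have "Polygamma (Suc m) z - (-1) ^ Suc m * Polygamma (Suc m) (1 - z)
      = - ((of_real pi * \<i>) ^ Suc m * (poly (pderiv (cot_poly m)) (icot z) * (of_real pi * \<i> * (1 - (icot z)\<^sup>2))))"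
    by (rule DERIV_unique)
  also have "\<dots> = - ((of_real pi * \<i>) ^ Suc (Suc m) * poly (cot_poly (Suc m)) (icot z))"
    by (simp add: power2_eq_square algebra_simps)
  finally show ?case .
qed

section \<open>Hurwitz zeta values as polygamma values\<close>

lemma hurwitz_zeta_eq_Polygamma:
  assumes "k > 1" "x > 0"
  shows "hurwitz_zeta (of_nat k) x = (-1) ^ k / fact (k - 1) * of_real (Polygamma (k - 1) x)"
proof -
  obtain m where m: "k = Suc m" "m > 0"
    using assms by (cases k) auto
  have "(of_nat n + complex_of_real x) powr (- of_nat k) = inverse ((of_real x + of_nat n) ^ k)" for n
  proof -
    have "of_nat n + complex_of_real x = of_real (real n + x)"
      by simp
    also have "\<dots> \<noteq> 0"
      using assms unfolding of_real_eq_0_iff by linarith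
    finally show ?thesis
      by (simp add: powr_minus powr_nat' add.commute)
  qed
  then have "hurwitz_zeta (of_nat k) x = (\<Sum>n. inverse ((of_real x + of_nat n) ^ k))"
    by (simp add: hurwitz_zeta_def)
  \<comment> \<open>As \<open>k > 1\<close>, the order \<open>k - 1\<close> is positive, where
    \<open>Polygamma\<close> is defined by the series.\<close>
  then have "complex_of_real (Polygamma (k - 1) x) = (-1) ^ k * fact (k - 1) * hurwitz_zeta (of_nat k) x"
    using m assms by (simp add: Polygamma_of_real[symmetric]) (simp add: Polygamma_def)
  then show ?thesis
    by (simp add: field_simps)
qed

text \<open>The division by \<open>(\<pi> \<i>) ^ k\<close> cancels exactly the power in the
  reflection formula and leaves an algebraic expression in the cotangent value.\<close>

lemma lambda_hz_eq_cot_poly: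
  assumes "k > 1" "0 < a" "a < q"
  shows "lambda_hz k q a = - ((-1) ^ k / fact (k - 1)) * poly (cot_poly (k - 1)) (icot (of_nat a / of_nat q))"
proof -
  define x where "x = real a / real q"
  have x: "0 < x" "x < 1" using assms by (simp_all add: x_def)
  have "complex_of_real x \<notin> \<int>"
  proof
    assume "complex_of_real x \<in> \<int>"
    then obtain n where "complex_of_real x = of_int n" by (elim Ints_cases)
    then have "x = of_int n"
      by (metis of_real_eq_iff of_real_of_int_eq)
    then show False using x by simp
  qed
  note refl = Polygamma_reflection_cot_poly[OF this, of "k - 1"]
  obtain m where m: "k = Suc m" "m > 0"
    using assms by (cases k) auto
  have "hurwitz_zeta (of_nat k) x + (-1) ^ k * hurwitz_zeta (of_nat k) (1 - x)
      = (-1) ^ k / fact (k - 1) * (Polygamma (k - 1) (of_real x) - (-1) ^ (k - 1) * Polygamma (k - 1) (1 - of_real x))"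
  proof -
    have "0 < 1 - x" using x by simp
    show ?thesis
      unfolding hurwitz_zeta_eq_Polygamma[OF assms(1) x(1)] hurwitz_zeta_eq_Polygamma[OF assms(1) \<open>0 < 1 - x\<close>]
      using x m Polygamma_of_real[of "1 - x" "k - 1", where 'a = complex] by (simp add: Polygamma_of_real algebra_simps)
  qed
  also have "\<dots> = (-1) ^ k / fact (k - 1) * - ((of_real pi * \<i>) ^ k * poly (cot_poly (k - 1)) (icot (of_real x)))"
    unfolding refl using m by simp
  finally show ?thesis
    by (simp add: lambda_hz_def x_def)
qed

text \<open>For comparing values: up to a nonzero factor depending only on \<open>k\<close>, this is
  a real function of \<open>a / q\<close>, open to monotonicity arguments.\<close>

lemma lambda_hz_eq_Polygamma:
  assumes "k > 1" "0 < a" "a < q"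
  defines "x \<equiv> real a / real q"
  shows "lambda_hz k q a = (-1) ^ k / (fact (k - 1) * (of_real pi * \<i>) ^ k)
           * of_real (Polygamma (k - 1) x + (-1) ^ k * Polygamma (k - 1) (1 - x))"
proof -
  have x: "0 < x" "x < 1" using assms by (simp_all add: x_def)
  then show ?thesis
    using assms(1) unfolding lambda_hz_def x_def[symmetric]
    by (simp add: hurwitz_zeta_eq_Polygamma field_simps)
qed

section \<open>Monotonicity of reflected polygamma combinations\<close>

lemma Polygamma_reflected_decreasing:
  fixes x y :: real
  assumes "odd m" "0 < x" "x < y" "y \<le> 1 / 2"
  shows "Polygamma m y + Polygamma m (1 - y) < Polygamma m x + Polygamma m (1 - x)"
proof (rule DERIV_neg_imp_decreasing_open[OF \<open>x < y\<close>])
  have nonpos: "t \<notin> \<int>\<^sub>\<le>\<^sub>0" "1 - t \<notin> \<int>\<^sub>\<le>\<^sub>0" if "0 < t" "t < 1" for t :: real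
    using that by (auto elim!: nonpos_Ints_cases)
  have deriv: "((\<lambda>t. Polygamma m t + Polygamma m (1 - t)) has_real_derivative
      Polygamma (Suc m) t - Polygamma (Suc m) (1 - t)) (at t)" if "0 < t" "t < 1" for t :: real
    using nonpos[OF that] by (auto intro!: derivative_eq_intros)
  \<comment> \<open>The derivative is negative because \<open>t < 1 - t\<close> and polygamma
    functions of even order increase.\<close>
  show "\<exists>d. ((\<lambda>t. Polygamma m t + Polygamma m (1 - t)) has_real_derivative d) (at t) \<and> d < 0"
    if "x < t" "t < y" for t
    using deriv[of t] Polygamma_real_strict_mono[of t "1 - t" "Suc m"] that assms
    by (intro exI[of _ "Polygamma (Suc m) t - Polygamma (Suc m) (1 - t)"]) auto
  show "continuous_on {x..y} (\<lambda>t. Polygamma m t + Polygamma m (1 - t))"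
    by (rule DERIV_continuous_on[OF has_field_derivative_at_within[OF deriv]]) (use assms in auto)
qed

text \<open>For even \<open>m\<close> the difference is strictly increasing. For odd
  \<open>m\<close> the sum is symmetric about 1/2, and \<open>h\<close> folds both points into the
  lower half, where it is strictly decreasing.\<close>

lemma Polygamma_reflected_inj:
  fixes x y :: real
  assumes "0 < x" "x < 1" "0 < y" "y < 1"
    and eq: "Polygamma m x + (-1) ^ Suc m * Polygamma m (1 - x)
      = Polygamma m y + (-1) ^ Suc m * Polygamma m (1 - y)"
  shows "y = x \<or> (odd m \<and> y = 1 - x)"
proof (cases "even m")
  case True
  have *: "Polygamma m x - Polygamma m (1 - x) < Polygamma m y - Polygamma m (1 - y)"
    if "x < y" "0 < x" "y < 1" for x y :: real
    using Polygamma_real_strict_mono[of x y m] Polygamma_real_strict_mono[of "1 - y" "1 - x" m] that True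
    by simp
  show ?thesis
    using *[of x y] *[of y x] eq assms True by (cases x y rule: linorder_cases) auto
next
  case False
  define f where "f t = Polygamma m t + Polygamma m (1 - t)" for t :: real
  define h where "h t = min t (1 - t)" for t :: real
  have h: "0 < h t" "h t \<le> 1 / 2" "f (h t) = f t" if "0 < t" "t < 1" for t
    using that by (auto simp: h_def f_def min_def)
  have "f (h x) = f (h y)"
    using eq False assms h by (simp add: f_def)
  then have "h x = h y"
    using Polygamma_reflected_decreasing[of m "h x" "h y"] Polygamma_reflected_decreasing[of m "h y" "h x"]
      h[of x] h[of y] assms False
    by (cases "h x" "h y" rule: linorder_cases) (auto simp: f_def)
  then show ?thesis
    using False by (auto simp: h_def min_def split: if_splits)
qed

lemma Polygamma_reflected_nonzero:
  fixes x :: real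
  assumes "m > 0" "0 < x" "x < 1 / 2"
  shows "Polygamma m x + (-1) ^ Suc m * Polygamma m (1 - x) \<noteq> 0"
proof (cases "even m")
  case True
  then show ?thesis
    using Polygamma_real_strict_mono[of x "1 - x" m] assms by simp
next
  case False
  moreover have "x \<notin> \<int>\<^sub>\<le>\<^sub>0" "1 - x \<notin> \<int>\<^sub>\<le>\<^sub>0"
    using assms by (auto elim!: nonpos_Ints_cases)
  ultimately show ?thesis
    using Polygamma_real_odd_pos[of x m] Polygamma_real_odd_pos[of "1 - x" m] by simp
qed

lemma lambda_hz_nonzero:
  assumes "k > 1" "0 < a" "real a < real q / 2"
  shows "lambda_hz k q a \<noteq> 0"
proof -
  have "k = Suc (k - 1)" "a < q" using assms by simp_all
  moreover have "real a / real q < 1 / 2"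
    using assms by (simp add: field_simps)
  ultimately show ?thesis
    using Polygamma_reflected_nonzero[of "k - 1" "real a / real q"] assms
    by (simp add: lambda_hz_eq_Polygamma flip: of_real_add of_real_mult del: of_real_add of_real_mult)
qed

lemma lambda_hz_eq_imp:
  assumes "k > 1" "0 < a" "a < q" "0 < b" "b < q" "lambda_hz k q a = lambda_hz k q b"
  shows "b = a \<or> (even k \<and> b = q - a)"
proof -
  have k: "k = Suc (k - 1)" using assms by simp
  let ?D = "\<lambda>x. Polygamma (k - 1) x + (-1) ^ k * Polygamma (k - 1) (1 - x)"
  have "complex_of_real (?D (real a / real q)) = complex_of_real (?D (real b / real q))"
    using assms unfolding lambda_hz_eq_Polygamma[OF assms(1-3)] lambda_hz_eq_Polygamma[OF assms(1,4,5)]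
    by (subst (asm) mult_left_cancel) simp_all
  then have "?D (real a / real q) = ?D (real b / real q)"
    by (simp only: of_real_eq_iff)
  then have "real b / real q = real a / real q \<or> odd (k - 1) \<and> real b / real q = 1 - real a / real q"
    using Polygamma_reflected_inj[of "real a / real q" "real b / real q" "k - 1"] assms k by simp
  then show ?thesis
  proof
    assume "odd (k - 1) \<and> real b / real q = 1 - real a / real q"
    moreover from this have "real b = real (q - a)"
      using assms by (simp add: field_simps of_nat_diff)
    ultimately show ?thesis using assms by auto
  qed (use assms in simp)
qed

section \<open>Parity and rationality of the cotangent polynomials\<close>

lemma cot_poly_minus: "pcompose (cot_poly m) [:0, -1:] = Polynomial.smult ((-1) ^ Suc m) (cot_poly m)"
proof (induction m)
  case (Suc m)
  have "pcompose (pderiv (cot_poly m)) [:0, -1:] * [:-1:] = pderiv (pcompose (cot_poly m) [:0, -1:])"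
    by (simp add: pderiv_pcompose pderiv_pCons)
  also have "\<dots> = Polynomial.smult ((-1) ^ Suc m) (pderiv (cot_poly m))"
    unfolding Suc by (rule pderiv_smult)
  finally have "pcompose (pderiv (cot_poly m)) [:0, -1:] = Polynomial.smult ((-1) ^ m) (pderiv (cot_poly m))"
    by (simp add: minus_equation_iff[of _ "Polynomial.smult _ _"])
  moreover have "pcompose [:1, 0, -1:] [:0, -1:] = [:1, 0, -1 :: complex:]"
    by (simp add: pcompose_pCons)
  ultimately show ?case
    unfolding cot_poly.simps pcompose_mult by (simp only: mult_smult_right) simp
qed (simp add: pcompose_pCons)

lemma poly_cot_poly_minus: "poly (cot_poly m) (- x) = (-1) ^ Suc m * poly (cot_poly m) x"
  using arg_cong[OF cot_poly_minus[of m], of "\<lambda>p. poly p x"] by (simp add: poly_pcompose)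

lemma coeff_cot_poly_Rats: "coeff (cot_poly m) n \<in> \<rat>"
proof (induction m arbitrary: n)
  case (Suc m)
  have "coeff (pderiv (cot_poly m)) n \<in> \<rat>" for n
    by (simp add: coeff_pderiv Suc del: of_nat_Suc)
  then show ?case
    by (simp add: coeff_pCons split: nat.split)
qed (simp add: coeff_pCons split: nat.split)

section \<open>Division values of the cotangent\<close>

lemma icot_minus: "icot (- z) = - icot z"
proof -
  define E where "E = exp (2 * of_real pi * \<i> * z)"
  have E: "E \<noteq> 0" by (simp add: E_def)
  have "icot (- z) = (inverse E + 1) / (inverse E - 1)"
    by (simp add: icot_def E_def exp_minus)
  also have "\<dots> = ((inverse E + 1) * E) / ((inverse E - 1) * E)"
    using E by simp
  also have "\<dots> = (E + 1) / (1 - E)"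
    using E by (simp add: algebra_simps)
  also have "\<dots> = - icot z"
    by (simp add: icot_def E_def minus_divide_right)
  finally show ?thesis .
qed

lemma icot_add_of_nat: "icot (z + of_nat n) = icot z"
proof -
  have "exp (2 * of_real pi * \<i> * (z + of_nat n)) = exp (2 * of_real pi * \<i> * z)"
    unfolding exp_eq by (intro exI[of _ "int n"]) (simp add: algebra_simps)
  then show ?thesis
    by (simp add: icot_def)
qed

lemma icot_one_minus: "icot (1 - z) = - icot z"
  using icot_add_of_nat[of "- z" 1] by (simp add: icot_minus add.commute)

text \<open>Inverts the Moebius map from the exponential to \<open>icot\<close>; the multiplicative
  form is convenient for taking powers.\<close>

lemma icot_plus_minus_one:
  assumes "z \<notin> \<int>"
  shows "icot z - 1 \<noteq> 0" "icot z + 1 = exp (2 * of_real pi * \<i> * z) * (icot z - 1)"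
proof -
  define E where "E = exp (2 * of_real pi * \<i> * z)"
  have E: "E - 1 \<noteq> 0"
    using exp_2pi_i_neq_1[OF assms] by (simp add: E_def)
  have "icot z = (E + 1) / (E - 1)"
    by (simp add: icot_def E_def)
  then have mult: "icot z * (E - 1) = E + 1"
    using E by simp
  show "icot z - 1 \<noteq> 0"
  proof
    assume "icot z - 1 = 0"
    then have "icot z = 1" by simp
    with mult have "E - 1 = E + 1" by simp
    then show False by (simp add: algebra_simps)
  qed
  show "icot z + 1 = exp (2 * of_real pi * \<i> * z) * (icot z - 1)"
    using mult unfolding E_def[symmetric] by (simp add: algebra_simps)
qed

lemma icot_power_eq:
  assumes "z \<notin> \<int>"
  shows "(icot z + 1) ^ n = exp (2 * of_real pi * \<i> * (of_nat n * z)) * (icot z - 1) ^ n"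
  unfolding icot_plus_minus_one(2)[OF assms] power_mult_distrib exp_of_nat_mult[symmetric]
  by (simp add: mult_ac)

text \<open>Multiple-angle formula, a rational function over the rationals. If \<open>n * z\<close>
  is an integer, both sides are 0 by the convention on division.\<close>

lemma icot_multiple:
  assumes "z \<notin> \<int>"
  shows "icot (of_nat n * z)
           = ((icot z + 1) ^ n + (icot z - 1) ^ n) / ((icot z + 1) ^ n - (icot z - 1) ^ n)"
proof -
  define W where "W = exp (2 * of_real pi * \<i> * (of_nat n * z))"
  have "(icot z - 1) ^ n \<noteq> 0"
    using icot_plus_minus_one(1)[OF assms] by simp
  then have "((W + 1) * (icot z - 1) ^ n) / ((W - 1) * (icot z - 1) ^ n) = (W + 1) / (W - 1)"
    by simp
  then show ?thesis
    unfolding icot_power_eq[OF assms] by (simp add: icot_def W_def algebra_simps)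
qed

lemma of_nat_divide_notin_Ints:
  assumes "0 < b" "b < q"
  shows "(of_nat b / of_nat q :: complex) \<notin> \<int>"
proof
  assume "(of_nat b / of_nat q :: complex) \<in> \<int>"
  then obtain n where "of_nat b / of_nat q = (of_int n :: complex)"
    by (elim Ints_cases)
  then have "(of_nat b :: complex) = of_int n * of_nat q"
    using assms by (simp add: field_simps)
  then have "of_int (int b) = (of_int (n * int q) :: complex)"
    by simp
  then have "int b = n * int q"
    by (simp only: of_int_eq_iff)
  then have "int q dvd int b" by simp
  then show False
    using assms by (auto dest: zdvd_imp_le)
qed

text \<open>\<open>icot\<close> determines the exponential, and the \<open>q\<close>-th roots of
  unity with exponents below \<open>q\<close> are distinct.\<close>

lemma inj_on_icot: "inj_on (\<lambda>b. icot (of_nat b / of_nat q)) {0<..<q}"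
proof (rule inj_onI)
  fix b c assume b: "b \<in> {0<..<q}" and c: "c \<in> {0<..<q}"
    and eq: "icot (of_nat b / of_nat q) = icot (of_nat c / of_nat q)"
  have "exp (2 * of_real pi * \<i> * (of_nat b / of_nat q)) = exp (2 * of_real pi * \<i> * (of_nat c / of_nat q))"
    using icot_plus_minus_one[OF of_nat_divide_notin_Ints[of b q]]
      icot_plus_minus_one[OF of_nat_divide_notin_Ints[of c q]] b c eq
    by (metis greaterThanLessThan_iff mult_right_cancel)
  then have "b mod q = c mod q"
    using complex_root_unity_eq[of q b c] b by simp
  then show "b = c"
    using b c by simp
qed

definition cot_division_poly :: "nat \<Rightarrow> complex poly" where
  "cot_division_poly q = [:1, 1:] ^ q - [:-1, 1:] ^ q"

text \<open>The terms of degree \<open>q\<close> cancel, so the degree is below \<open>q\<close>,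
  while the \<open>q - 1\<close> cotangent values are distinct roots.\<close>

lemma cot_division_poly_factor:
  assumes "q > 0"
  obtains c where "cot_division_poly q
    = Polynomial.smult c (\<Prod>r\<in>(\<lambda>b. icot (of_nat b / of_nat q)) ` {0<..<q}. [:- r, 1:])"
    "c = lead_coeff (cot_division_poly q)" "c \<noteq> 0"
proof -
  define A where "A = cot_division_poly q"
  define S where "S = (\<lambda>b. icot (of_nat b / of_nat q)) ` {0<..<q}"
  define P where "P = (\<Prod>r\<in>S. [:- r, 1:])"
  have A_nz: "A \<noteq> 0"
  proof
    assume "A = 0"
    then have "poly A 1 = 0" by simp
    then show False using assms by (simp add: A_def cot_division_poly_def zero_power)
  qed
  have "degree A \<le> q"
    unfolding A_def cot_division_poly_def by (rule degree_diff_le) (simp_all add: degree_linear_power)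
  moreover have "coeff A q = 0"
    by (simp add: A_def cot_division_poly_def coeff_linear_power)
  ultimately have "degree A < q"
    using A_nz by (metis le_neq_implies_less leading_coeff_0_iff)
  have "card S = q - 1"
    unfolding S_def by (subst card_image[OF inj_on_icot]) simp
  then have deg_P: "degree P = q - 1"
    unfolding P_def by (subst degree_prod_eq_sum_degree) auto
  have root: "poly A (icot (of_nat b / of_nat q)) = 0" if "b \<in> {0<..<q}" for b
  proof -
    have "exp (2 * of_real pi * \<i> * (of_nat q * (of_nat b / of_nat q))) = 1"
      using complex_root_unity_eq_1[of q "b * q"] assms by (simp add: mult_ac)
    then show ?thesis
      using that icot_power_eq[OF of_nat_divide_notin_Ints[of b q], of q]
      by (simp add: A_def cot_division_poly_def add.commute)
  qed
  have "P dvd A"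
    unfolding P_def using root by (intro prod_linear_dvd) (auto simp: S_def)
  then obtain C where C: "A = P * C" by (elim dvdE)
  have "P \<noteq> 0" "C \<noteq> 0" using A_nz C by auto
  then have "degree A = degree P + degree C"
    unfolding C by (rule degree_mult_eq)
  then have "degree C = 0"
    using \<open>degree A < q\<close> deg_P by simp
  then obtain c where c: "C = [:c:]" by (elim degree_eq_zeroE)
  have A: "A = Polynomial.smult c P" by (simp add: C c)
  have "lead_coeff P = 1"
    by (simp add: P_def lead_coeff_prod)
  then have "c = lead_coeff A" "c \<noteq> 0"
    using A A_nz by auto
  then show thesis
    using that[of c] A unfolding A_def P_def S_def by blast
qed

context complex_subfield
begin

lemma polys_linear_power: "[:of_int a, 1:] ^ n \<in> polys"
  by (intro polys_power polys_pCons of_int_closed one_closed polys_zero)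

lemma reflection_factor_closed: "- ((-1) ^ k / fact n) \<in> K"
  by (intro uminus_closed divide_closed power_closed one_closed Rats_closed
      subsetD[OF Ints_subset_Rats fact_in_Ints])

lemma polys_common_icot:
  assumes "q > 0" and B: "B \<in> polys"
  shows "(\<Prod>r\<in>{r \<in> (\<lambda>b. icot (of_nat b / of_nat q)) ` {0<..<q}. poly B r = 0}. [:- r, 1:]) \<in> polys"
proof (rule polys_common_roots[OF _ _ B])
  have A: "cot_division_poly q \<in> polys"
    unfolding cot_division_poly_def
    using polys_linear_power[of 1 q] polys_linear_power[of "-1" q] by (intro polys_diff) simp_all
  obtain c where c: "cot_division_poly q
      = Polynomial.smult c (\<Prod>r\<in>(\<lambda>b. icot (of_nat b / of_nat q)) ` {0<..<q}. [:- r, 1:])"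
    "c = lead_coeff (cot_division_poly q)" "c \<noteq> 0"
    using cot_division_poly_factor[OF assms(1)] .
  have "Polynomial.smult (inverse c) (cot_division_poly q) \<in> polys"
    unfolding c(2) by (intro polys_smult inverse_closed polys_coeff A)
  then show "(\<Prod>r\<in>(\<lambda>b. icot (of_nat b / of_nat q)) ` {0<..<q}. [:- r, 1:]) \<in> polys"
    using c(3) by (simp add: c(1))
qed simp

text \<open>The common roots of \<open>B\<close> and the division polynomial are \<open>y\<close>
  and, for even \<open>k\<close>, also \<open>- y\<close>, because no other index gives the same
  \<open>\<lambda>\<close>. The monic polynomial with these roots has coefficients in
  \<open>K\<close>.\<close>

lemma icot_closed_of_lambda_hz:
  assumes k: "k > 1" and a: "0 < a" "real a < real q / 2" and lam: "lambda_hz k q a \<in> K"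
  defines "y \<equiv> icot (of_nat a / of_nat q)"
  shows "y\<^sup>2 \<in> K" "odd k \<Longrightarrow> y \<in> K"
proof -
  have q: "q > 0" "a < q" "q - a \<noteq> a" "0 < q - a" "q - a < q"
    using a by auto
  define B where "B = Polynomial.smult (- ((-1) ^ k / fact (k - 1))) (cot_poly (k - 1)) - [:lambda_hz k q a:]"
  have "B \<in> polys"
    unfolding B_def
  proof (intro polys_diff polys_smult polys_pCons lam polys_zero)
    show "- ((-1) ^ k / fact (k - 1)) \<in> K"
      by (rule reflection_factor_closed)
    show "cot_poly (k - 1) \<in> polys"
      by (intro polysI Rats_closed coeff_cot_poly_Rats)
  qed
  note common = polys_common_icot[OF q(1) this]
  have B: "poly B (icot (of_nat b / of_nat q)) = lambda_hz k q b - lambda_hz k q a" if "0 < b" "b < q" for b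
    using that k by (simp add: B_def lambda_hz_eq_cot_poly)
  let ?T = "{r \<in> (\<lambda>b. icot (of_nat b / of_nat q)) ` {0<..<q}. poly B r = 0}"
  have y_mem: "y \<in> ?T"
    using a q B[of a] by (auto simp: y_def)
  have reflect: "icot (of_nat (q - a) / of_nat q) = - y"
    using icot_one_minus[of "of_nat a / of_nat q"] q by (simp add: y_def of_nat_diff diff_divide_distrib)
  have sub: "r = y \<or> (even k \<and> r = - y)" if "r \<in> ?T" for r
  proof -
    from that obtain b where b: "0 < b" "b < q" "r = icot (of_nat b / of_nat q)" "poly B r = 0"
      by auto
    then have "lambda_hz k q a = lambda_hz k q b"
      using B[of b] by simp
    then have "b = a \<or> (even k \<and> b = q - a)"
      using lambda_hz_eq_imp[OF k a(1) q(2) b(1,2)] by blast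
    then show ?thesis
      using b reflect by (auto simp: y_def)
  qed
  show odd: "y \<in> K" if "odd k"
  proof -
    have "?T = {y}"
      using sub y_mem that by blast
    then have "[:- y, 1:] \<in> polys"
      using common by simp
    from uminus_closed[OF polys_coeff[OF this, of 0]] show ?thesis
      by simp
  qed
  show "y\<^sup>2 \<in> K"
  proof (cases "even k")
    case True
    have "y \<noteq> - y"
    proof
      assume "y = - y"
      then have "icot (of_nat a / of_nat q) = icot (of_nat (q - a) / of_nat q)"
        unfolding reflect by (simp add: y_def)
      then have "a = q - a"
        by (rule inj_onD[OF inj_on_icot]) (use a q in auto)
      then show False
        using q by simp
    qed
    have "- y \<in> ?T"
    proof -
      have "poly (cot_poly (k - 1)) (- y) = poly (cot_poly (k - 1)) y"
        using True k by (simp add: poly_cot_poly_minus)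
      then have "poly B (- y) = poly B y"
        by (simp add: B_def)
      then have "poly B (- y) = 0"
        using y_mem by simp
      moreover have "- y \<in> (\<lambda>b. icot (of_nat b / of_nat q)) ` {0<..<q}"
        unfolding reflect[symmetric] by (rule imageI) (use q in simp)
      ultimately show ?thesis
        by simp
    qed
    then have "?T = {y, - y}"
      using sub y_mem by blast
    \<comment> \<open>The constant coefficient of this product is
      \<open>- y\<^sup>2\<close>.\<close>
    then have "[:- y, 1:] * [:y, 1:] \<in> polys"
      using common \<open>y \<noteq> - y\<close> by simp
    from uminus_closed[OF polys_coeff[OF this, of 0]] show ?thesis
      by (simp add: power2_eq_square)
  qed (use odd in \<open>simp add: power_closed\<close>)
qed

text \<open>As \<open>a\<close> is invertible modulo \<open>q\<close>, some multiple
  \<open>n * a\<close> is congruent to \<open>b\<close>, and the multiple-angle formula makes the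
  cotangent value of \<open>b\<close> a rational function of that of \<open>a\<close>.\<close>

theorem lambda_hz_closed:
  assumes k: "k > 1" and a: "0 < a" "real a < real q / 2" "coprime a q"
    and lam: "lambda_hz k q a \<in> K" and b: "0 < b" "b < q"
  shows "lambda_hz k q b \<in> K"
proof -
  define y where "y = icot (of_nat a / of_nat q)"
  have y: "y\<^sup>2 \<in> K" "odd k \<Longrightarrow> y \<in> K"
    using icot_closed_of_lambda_hz[OF k a(1,2) lam] by (simp_all add: y_def)
  have q: "q > 0" "a < q" using a by auto
  obtain x where x: "[a * x = Suc 0] (mod q)"
    using cong_solve_coprime_nat[OF a(3)] by blast
  define n where "n = x * b"
  have "[a * n = b] (mod q)"
    using cong_mult[OF x cong_refl[of b]] by (simp add: n_def mult.assoc)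
  then have "(a * n) mod q = b"
    using b by (simp add: cong_def)
  then obtain m where "a * n = b + q * m"
    by (metis mod_mult_div_eq)
  then have m: "(of_nat (a * n) :: complex) = of_nat (b + q * m)"
    by (rule arg_cong)
  have "of_nat n * (of_nat a / of_nat q :: complex) = of_nat (a * n) / of_nat q"
    by simp
  also have "\<dots> = of_nat b / of_nat q + of_nat m"
    unfolding m using q by (simp add: add_divide_distrib)
  finally have "of_nat n * (of_nat a / of_nat q :: complex) = of_nat b / of_nat q + of_nat m" .
  then have yb: "icot (of_nat b / of_nat q) = ((y + 1) ^ n + (y - 1) ^ n) / ((y + 1) ^ n - (y - 1) ^ n)"
    using icot_add_of_nat[of "of_nat b / of_nat q" m]
      icot_multiple[OF of_nat_divide_notin_Ints[OF a(1) q(2)], of n] by (simp add: y_def)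
  define N where "N = [:1, 1:] ^ n + [:-1, 1 :: complex:] ^ n"
  define D where "D = [:1, 1:] ^ n - [:-1, 1 :: complex:] ^ n"
  have ND: "N \<in> polys" "D \<in> polys"
    unfolding N_def D_def using polys_linear_power[of 1 n] polys_linear_power[of "-1" n]
    by (auto intro: polys_add polys_diff)
  have yb: "icot (of_nat b / of_nat q) = poly N y / poly D y"
    by (simp add: yb N_def D_def add.commute)
  have lam_b: "lambda_hz k q b = - ((-1) ^ k / fact (k - 1)) * poly (cot_poly (k - 1)) (icot (of_nat b / of_nat q))"
    by (rule lambda_hz_eq_cot_poly[OF k b])
  have cot_polys: "cot_poly (k - 1) \<in> polys"
    by (intro polysI Rats_closed coeff_cot_poly_Rats)
  have "poly (cot_poly (k - 1)) (icot (of_nat b / of_nat q)) \<in> K"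
  proof (cases "even k")
    case True
    \<comment> \<open>\<open>N\<close> has the parity of \<open>n\<close> and \<open>D\<close> the
      opposite one, so both squares are even and \<open>y\<^sup>2 \<in> K\<close> suffices.\<close>
    have sq: "(poly N (- y))\<^sup>2 = (poly N y)\<^sup>2" "(poly D (- y))\<^sup>2 = (poly D y)\<^sup>2"
    proof -
      have "1 - y = (-1) * (y - 1)" "- 1 - y = (-1) * (y + 1)"
        by simp_all
      then have minus: "(1 - y) ^ n = (-1) ^ n * (y - 1) ^ n" "(- 1 - y) ^ n = (-1) ^ n * (y + 1) ^ n"
        by (simp_all only: power_mult_distrib)
      have "poly N (- y) = (1 - y) ^ n + (- 1 - y) ^ n" "poly D (- y) = (1 - y) ^ n - (- 1 - y) ^ n"
        by (simp_all add: N_def D_def)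
      moreover have "poly N y = (y + 1) ^ n + (y - 1) ^ n" "poly D y = (y + 1) ^ n - (y - 1) ^ n"
        by (simp_all add: N_def D_def add.commute)
      ultimately have "poly N (- y) = (-1) ^ n * poly N y" "poly D (- y) = - ((-1) ^ n * poly D y)"
        by (simp_all only: minus right_diff_distrib distrib_left) simp_all
      then show "(poly N (- y))\<^sup>2 = (poly N y)\<^sup>2" "(poly D (- y))\<^sup>2 = (poly D y)\<^sup>2"
        by (simp_all add: power_mult_distrib flip: power_mult)
    qed
    have "poly (N ^ 2) y \<in> K" "poly (D ^ 2) y \<in> K"
      using sq by (intro poly_even_closed polys_power ND y(1); simp)+
    then have "(icot (of_nat b / of_nat q))\<^sup>2 \<in> K"
      by (simp add: yb power_divide divide_closed)
    \<comment> \<open>For even \<open>k\<close> also \<open>cot_poly (k - 1)\<close> is even, so the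
      square of the cotangent value is enough.\<close>
    moreover have "even k \<Longrightarrow> Suc (k - 1) = k" using k by simp
    ultimately show ?thesis
      using True by (intro poly_even_closed cot_polys) (simp_all add: poly_cot_poly_minus)
  next
    case False
    then show ?thesis
      unfolding yb by (intro poly_closed cot_polys divide_closed ND y(2))
  qed
  then show ?thesis
    unfolding lam_b by (intro mult_closed reflection_factor_closed)
qed

end

section \<open>Dimension of the span\<close>

lemma complex_field_simps [simp]:
  "carrier complex_field = UNIV"
  "x \<otimes>\<^bsub>complex_field\<^esub> y = x * y" "x \<oplus>\<^bsub>complex_field\<^esub> y = x + y"
  "\<one>\<^bsub>complex_field\<^esub> = 1" "\<zero>\<^bsub>complex_field\<^esub> = 0"
  by (simp_all add: ring_of_type_algebra_def)

interpretation complex_field: ring complex_field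
  by (rule field.is_ring) (rule field_from_type_algebra)

text \<open>Turns a linear relation between powers into a polynomial equation; the offset
  \<open>m\<close> is there for the induction.\<close>

lemma combine_powers:
  "complex_field.combine Ks (map (\<lambda>i. x ^ i) [m..<m + length Ks]) = x ^ m * poly (Poly Ks) x"
proof (induction Ks arbitrary: m)
  case (Cons c Ks)
  have "[m..<m + length (c # Ks)] = m # [Suc m..<Suc m + length Ks]"
    by (simp add: upt_conv_Cons del: upt_Suc)
  then show ?case
    using Cons.IH[of "Suc m"] by (simp add: algebra_simps del: upt_Suc)
qed simp

text \<open>In a space of dimension \<open>n\<close> over the rationals, \<open>n + 1\<close> powers
  of \<open>x\<close> are dependent.\<close>

lemma number_field_imp_algebraic:
  assumes "number_field K" "x \<in> K"
  shows "algebraic x"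
proof -
  from assms(1) have K: "complex_subfield K" and fin: "complex_field.finite_dimension \<rat> K"
    by (auto simp: number_field_def complex_subfield_if_subfield)
  obtain n where n: "complex_field.dimension n \<rat> K"
    using fin by (rule complex_field.finite_dimensionE')
  define Us where "Us = map (\<lambda>i. x ^ i) [0..<Suc n]"
  have len: "length Us = Suc n"
    by (simp add: Us_def)
  have "\<not> complex_field.independent \<rat> Us"
  proof
    assume "complex_field.independent \<rat> Us"
    moreover have "set Us \<subseteq> K"
      using complex_subfield.power_closed[OF K assms(2)] by (auto simp: Us_def)
    ultimately have "length Us \<le> n"
      using complex_field.independent_length_le_dimension[OF subfield_Rats n] by blast
    then show False using len by simp
  qed
  then obtain Ks where Ks: "length Ks = length Us" "complex_field.combine Ks Us = 0"
    "set Ks \<subseteq> \<rat>" "set Ks \<noteq> {0}"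
    using complex_field.dependent_imp_non_trivial_combine[OF subfield_Rats, of Us] by auto
  show ?thesis
  proof (rule algebraicI')
    show "coeff (Poly Ks) i \<in> \<rat>" for i
      using Ks(3) by (auto simp: nth_default_def)
    have "Us = map (\<lambda>i. x ^ i) [0..<0 + length Ks]"
      using Ks(1) len by (simp add: Us_def)
    then show "poly (Poly Ks) x = 0"
      using Ks(2) combine_powers[of Ks x 0] by simp
    show "Poly Ks \<noteq> 0"
    \<comment> \<open>\<open>Poly\<close> only strips trailing zeros, so it is 0 only if every entry
      of \<open>Ks\<close> is.\<close>
    proof
      assume "Poly Ks = 0"
      then have "nth_default 0 Ks i = 0" for i
        by (metis coeff_0 coeff_Poly)
      then have "Ks ! i = 0" if "i < length Ks" for i
        using that by (metis nth_default_nth)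
      then have "set Ks \<subseteq> {0}"
        by (auto simp: in_set_conv_nth)
      moreover have "set Ks \<noteq> {}"
        using Ks(1) len by auto
      ultimately have "set Ks = {0}"
        by (metis subset_singletonD)
      with Ks(4) show False ..
    qed
  qed
qed

lemma pi_i_power_notin_number_field:
  assumes "number_field K" "k > 0"
  shows "(of_real pi * \<i>) ^ k \<notin> K"
proof
  assume "(of_real pi * \<i>) ^ k \<in> K"
  then have "algebraic ((of_real pi * \<i>) ^ k)"
    by (rule number_field_imp_algebraic[OF assms(1)])
  then have "algebraic (of_real pi * \<i>)"
    by (rule algebraic_root[where p = "monom 1 k"])
      (use assms(2) in \<open>simp_all add: poly_monom degree_monom_eq\<close>)
  then show False
    using pi_i_transcendental by simp
qed

section \<open>Spans and dimension over a subfield\<close>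

lemma ex_independent_Span:
  assumes "subfield K complex_field"
  shows "\<exists>Vs. complex_field.independent K Vs \<and> complex_field.Span K Vs = complex_field.Span K Us
    \<and> length Vs \<le> length Us"
proof (induction Us)
  case Nil
  then show ?case
    by (intro exI[of _ "[]"]) simp
next
  case (Cons u Us)
  then obtain Vs where Vs: "complex_field.independent K Vs"
    "complex_field.Span K Vs = complex_field.Span K Us" "length Vs \<le> length Us"
    by blast
  show ?case
  proof (cases "u \<in> complex_field.Span K Vs")
    \<comment> \<open>A generator in the span of the later ones is discarded.\<close>
    case True
    have "complex_field.Span K (u # Us) = complex_field.Span K Us"
    proof
      show "complex_field.Span K (u # Us) \<subseteq> complex_field.Span K Us"
        using True Vs complex_field.Span_base_incl[OF assms, of Us]
        by (intro complex_field.mono_Span_subset[OF assms]) auto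
      show "complex_field.Span K Us \<subseteq> complex_field.Span K (u # Us)"
        by (intro complex_field.mono_Span[OF assms]) auto
    qed
    then show ?thesis
      using Vs by (intro exI[of _ Vs]) simp
  next
    case False
    then show ?thesis
      using Vs by (intro exI[of _ "u # Vs"]) (simp add: complex_field.li_Cons)
  qed
qed

lemma dim_le_length_Span:
  assumes K: "subfield K complex_field" and dim: "complex_field.dimension n K E"
    and sub: "E \<subseteq> complex_field.Span K Us"
  shows "n \<le> length Us"
proof -
  obtain Bs where Bs: "complex_field.independent K Bs" "length Bs = n" "complex_field.Span K Bs = E"
    using complex_field.exists_base[OF K dim] by blast
  obtain Vs where Vs: "complex_field.independent K Vs"
    "complex_field.Span K Vs = complex_field.Span K Us" "length Vs \<le> length Us"
    using ex_independent_Span[OF K] by blast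
  have "set Bs \<subseteq> complex_field.Span K Vs"
    using complex_field.Span_base_incl[OF K, of Bs] Bs Vs sub by auto
  then show ?thesis
    using complex_field.independent_length_le[OF K Bs(1) Vs(1)] Bs Vs by simp
qed

text \<open>The span of 1 is \<open>K\<close> itself, so \<open>v\<close> and 1 are
  independent.\<close>

lemma two_le_dim:
  assumes K: "subfield K complex_field" and dim: "complex_field.dimension n K E"
    and E: "1 \<in> E" "v \<in> E" and v: "v \<notin> K"
  shows "2 \<le> n"
proof -
  have "complex_field.independent K [1]"
    by (intro complex_field.li_Cons complex_field.li_Nil) simp_all
  moreover have "v \<notin> complex_field.Span K [1]"
    using v by (auto simp: complex_field.line_extension_mem_iff)
  ultimately have "complex_field.independent K [v, 1]"
    by (intro complex_field.li_Cons) simp_all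
  from complex_field.independent_length_le_dimension[OF K dim this] E show ?thesis
    by simp
qed

section \<open>Totatives in the lower half\<close>

lemma coprime_imp_double_neq:
  fixes b q :: nat
  assumes "q > 2" "coprime b q"
  shows "2 * b \<noteq> q"
proof
  assume "2 * b = q"
  then have "b dvd q" by auto
  then have "b = 1"
    using assms(2) by (metis coprime_common_divisor_nat dvd_refl)
  then show False
    using \<open>2 * b = q\<close> assms(1) by simp
qed

lemma coprime_diff_self:
  fixes b q :: nat
  shows "coprime b q \<Longrightarrow> b \<le> q \<Longrightarrow> coprime (q - b) q"
  by (metis coprime_iff_gcd_eq_1 gcd.commute gcd_diff2_nat)

text \<open>The reflection of \<open>b\<close> to \<open>q - b\<close> pairs the totatives below
  \<open>q / 2\<close> with those above; none equals \<open>q / 2\<close> because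
  \<open>q > 2\<close>.\<close>

lemma length_filter_totatives_less_half:
  assumes "q > 2"
  shows "2 * length (filter (\<lambda>b. coprime b q \<and> 2 * b < q) [1..<q]) = totient q"
proof -
  define L where "L = {b \<in> {1..<q}. coprime b q \<and> 2 * b < q}"
  have "totatives q = L \<union> (\<lambda>b. q - b) ` L"
  proof (intro equalityI subsetI)
    fix b assume b: "b \<in> totatives q"
    then have b': "0 < b" "b < q" "coprime b q"
      using assms totatives_less[of b q] by (auto simp: totatives_def)
    show "b \<in> L \<union> (\<lambda>b. q - b) ` L"
    proof (cases "2 * b < q")
      case False
      then have "q - b \<in> L"
        using b' coprime_imp_double_neq[OF assms b'(3)] by (auto simp: L_def coprime_diff_self)
      moreover have "b = q - (q - b)" using b' by simp
      ultimately show ?thesis by blast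
    qed (use b' in \<open>simp add: L_def\<close>)
  next
    fix b assume "b \<in> L \<union> (\<lambda>b. q - b) ` L"
    then show "b \<in> totatives q"
      by (auto simp: L_def totatives_def coprime_diff_self)
  qed
  moreover have "L \<inter> (\<lambda>b. q - b) ` L = {}" "finite L"
    by (auto simp: L_def)
  moreover have "inj_on (\<lambda>b. q - b) L"
    by (auto simp: inj_on_def L_def)
  ultimately have "totient q = 2 * card L"
    unfolding totient_def by (simp add: card_Un_disjoint card_image)
  also have "L = set (filter (\<lambda>b. coprime b q \<and> 2 * b < q) [1..<q])"
    by (auto simp: L_def)
  also have "card \<dots> = length (filter (\<lambda>b. coprime b q \<and> 2 * b < q) [1..<q])"
    by (rule distinct_card) simp
  finally show ?thesis by simp
qed

lemma lambda_hz_mult_pi_power: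
  assumes "b < q"
  shows "lambda_hz k q b * (of_real pi * \<i>) ^ k
    = hurwitz_zeta (of_nat k) (real b / real q) + (-1) ^ k * hurwitz_zeta (of_nat k) (real (q - b) / real q)"
proof -
  have "1 - real b / real q = real (q - b) / real q"
    using assms by (simp add: of_nat_diff diff_divide_distrib)
  then show ?thesis
    by (simp add: lambda_hz_def)
qed

section \<open>Lower and upper bound for the dimension\<close>

theorem theorem4p1:
  fixes k q :: nat and K :: "complex set"
  assumes "k > 1" and "q > 2"
    and "number_field K"
    and "\<exists>a. 1 \<le> a \<and> real a < real q / 2 \<and> coprime a q \<and> lambda_hz k q a \<in> K"
  shows "2 \<le> ((ring.dim complex_field) over K) (V_hat k q K)
       \<and> real (((ring.dim complex_field) over K) (V_hat k q K)) \<le> real (totient q) / 2 + 2"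
proof -
  have K: "subfield K complex_field"
    using assms(3) by (simp add: number_field_def)
  interpret K: complex_subfield K
    by (rule complex_subfield_if_subfield[OF K])
  define n where "n = ((ring.dim complex_field) over K) (V_hat k q K)"
  have dim: "complex_field.dimension n K (V_hat k q K)"
    unfolding n_def by (rule complex_field.finite_dimensionE[OF K finite_dimension_V_hat[OF assms(3)]])
  define Z where "Z b = hurwitz_zeta (of_nat k) (real b / real q)" for b
  have V_hat: "V_hat k q K = complex_field.Span K (1 # map Z (filter (\<lambda>a. coprime a q) [1..<q]))"
    by (simp add: V_hat_def Z_def[abs_def])
  have V_hat_base: "1 \<in> V_hat k q K" "\<And>b. 0 < b \<Longrightarrow> b < q \<Longrightarrow> coprime b q \<Longrightarrow> Z b \<in> V_hat k q K"
    using complex_field.Span_base_incl[OF K, of "1 # map Z (filter (\<lambda>a. coprime a q) [1..<q])"]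
    unfolding V_hat by auto
  obtain a where a: "0 < a" "real a < real q / 2" "coprime a q" "lambda_hz k q a \<in> K"
    using assms(4) by (auto simp: Suc_le_eq)
  have a_less: "a < q" using a by simp
  have lam: "lambda_hz k q b * (of_real pi * \<i>) ^ k = Z b + (-1) ^ k * Z (q - b)" if "b < q" for b
    unfolding Z_def by (rule lambda_hz_mult_pi_power[OF that])

  \<comment> \<open>Otherwise \<open>K\<close> would contain \<open>(\<pi> \<i>) ^ k\<close>,
    recovered by dividing by the nonzero \<open>\<lambda>\<close> of \<open>a\<close>, against the
    transcendence of \<open>\<pi>\<close>.\<close>
  have "Z a \<notin> K \<or> Z (q - a) \<notin> K"
  proof (rule ccontr)
    assume "\<not> (Z a \<notin> K \<or> Z (q - a) \<notin> K)"
    then have "(Z a + (-1) ^ k * Z (q - a)) / lambda_hz k q a \<in> K"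
      by (intro K.divide_closed K.add_closed K.mult_closed K.power_closed K.uminus_closed K.one_closed a) auto
    also have "(Z a + (-1) ^ k * Z (q - a)) / lambda_hz k q a = (of_real pi * \<i>) ^ k"
      unfolding lam[OF a_less, symmetric] using lambda_hz_nonzero[OF assms(1) a(1,2)] by simp
    finally show False
      using pi_i_power_notin_number_field[OF assms(3), of k] assms(1) by simp
  qed
  \<comment> \<open>\<open>q - a\<close> is coprime to \<open>q\<close> too, so whichever value lies
    outside \<open>K\<close> belongs to the span.\<close>
  then have "2 \<le> n"
    using two_le_dim[OF K dim V_hat_base(1) V_hat_base(2)[of a]]
      two_le_dim[OF K dim V_hat_base(1) V_hat_base(2)[of "q - a"]] a a_less
    by (auto simp: coprime_diff_self)

  \<comment> \<open>For the upper bound: once \<open>(\<pi> \<i>) ^ k\<close> is adjoined, the zeta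
    values in the lower half generate those in the upper half.\<close>
  define Ws where "Ws = 1 # (of_real pi * \<i>) ^ k # map Z (filter (\<lambda>b. coprime b q \<and> 2 * b < q) [1..<q])"
  have base: "w \<in> complex_field.Span K Ws" if "w \<in> set Ws" for w
    using complex_field.Span_base_incl[OF K, of Ws] that by auto
  have add: "x + y \<in> complex_field.Span K Ws" if "x \<in> complex_field.Span K Ws" "y \<in> complex_field.Span K Ws" for x y
    using complex_field.Span_subgroup_props(3)[OF K, of Ws x y] that by simp
  have smult: "c * x \<in> complex_field.Span K Ws" if "c \<in> K" "x \<in> complex_field.Span K Ws" for c x
    using complex_field.Span_smult_closed[OF K, of Ws c x] that by simp
  have Z_mem: "Z b \<in> complex_field.Span K Ws" if b: "0 < b" "b < q" "coprime b q" for b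
  proof (cases "2 * b < q")
    case True
    then show ?thesis
      using b by (intro base) (auto simp: Ws_def)
  next
    case False
    define c where "c = q - b"
    have "2 * b \<noteq> q"
      by (rule coprime_imp_double_neq[OF assms(2) b(3)])
    then have c: "0 < c" "c < q" "coprime c q" "2 * c < q" "q - c = b"
      using b False by (auto simp: c_def coprime_diff_self)
    have sign: "(-1) ^ k \<in> K"
      by (intro K.power_closed K.uminus_closed K.one_closed)
    \<comment> \<open>The relation for \<open>c = q - b\<close> solved for \<open>Z b\<close>, the
      sign \<open>(-1) ^ k\<close> being its own inverse.\<close>
    have "Z b = (-1) ^ k * (Z c + (-1) ^ k * Z (q - c)) + (- ((-1) ^ k)) * Z c"
      by (simp add: c(5) algebra_simps flip: power_mult_distrib)
    also have "\<dots> = ((-1) ^ k * lambda_hz k q c) * (of_real pi * \<i>) ^ k + (- ((-1) ^ k)) * Z c"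
      unfolding lam[OF c(2), symmetric] by simp
    also have "\<dots> \<in> complex_field.Span K Ws"
      using K.lambda_hz_closed[OF assms(1) a c(1,2)] c
      by (intro add smult base K.mult_closed K.uminus_closed sign) (auto simp: Ws_def)
    finally show ?thesis .
  qed
  have "V_hat k q K \<subseteq> complex_field.Span K Ws"
    unfolding V_hat using Z_mem base[of 1]
    by (intro complex_field.mono_Span_subset[OF K]) (auto simp: Ws_def)
  then have "n \<le> length Ws"
    by (rule dim_le_length_Span[OF K dim])
  \<comment> \<open>The two extra generators 1 and \<open>(\<pi> \<i>) ^ k\<close> account for the
    4; doubling avoids halving in the naturals.\<close>
  then have "2 * n \<le> totient q + 4"
    using length_filter_totatives_less_half[OF assms(2)] by (simp add: Ws_def)
  then have "real n \<le> real (totient q) / 2 + 2"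
    by linarith
  with \<open>2 \<le> n\<close> show ?thesis
    unfolding n_def by blast
qed

end
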